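(* Let $p$ be an odd prime and let $k\ge p$ be an integer. Suppose that there are $(p+1)/2$ active users out of $p-1$ potential users in the collision channel without feedback. Put $$D(p,k)=\tfrac12\,[kp+k-p+3].$$ Using the modified CRT sequences with parameters $p$ and $q=kp+1$ as protocol sequences, each active user can send $D(p,k)$ information packets in a period of $p(kp+1)$ time slots. In particular, if $k=p$, the resulting CRT sequences have period $p^3+p$, and when $(p+1)/2$ users are active the system throughput is lower bounded by $$\frac{p+1}{2}\cdot\frac{0.5\,(p^2+3)}{p^3+p}\ \ge\ 0.25 .$$
   Context: Modified CRT sequences: for $p$ prime and $q$ relatively prime to $p$, let $\gamma p\equiv1\bmod q$, $\Phi'_{p,q}(x)=(x\bmod p,\ \gamma x\bmod q)$ from $\mathbb{Z}_{pq}$ to $\mathbb{Z}_p\oplus\mathbb{Z}_q$, and $\mathcal{I}_g=\{(gt\bmod p,\ t):0\le t<q\}$. For $g=1,\ldots,p-1$, the sequence $s_g$ assigned to user $g$ has period $L=pq$ with $s_g(t)=1$ iff $\Phi'_{p,q}(t)\in\mathcal{I}_g$. Channel: time is slotted; there is one receiver, no feedback and no cooperation. A packet is a symbol of an alphabet of size $Q$, where $Q$ is a prime power with $Q\ge kp+1$. Each active user $g$ has an arbitrary delay offset (unknown to the receiver) and sends a packet in exactly those slots in which its shifted sequence equals 1. The channel output in a slot is $0$ if nobody transmits, $*$ (collision, packets lost) if two or more users transmit, and the packet content $x$ if exactly one user transmits; packets carry no header, and the receiver is not told which users are active. "An active user can send $D$ information packets in a period" means that the user can encode $D$ information packets into the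 packets it transmits in one sequence period so that, whatever the delay offsets, the receiver can recover these $D$ information packets from the channel output. The system throughput is the total number of information packets so conveyed by all active users per period, divided by the period length. *)

theory Defs
  imports Complex_Main "HOL-Number_Theory.Number_Theory"
begin

section \<open>Modified CRT sequences\<close>

definition mcrt_map :: "nat \<Rightarrow> nat \<Rightarrow> nat \<Rightarrow> nat \<Rightarrow> nat \<times> nat" where
  "mcrt_map p q \<gamma> t = (t mod p, \<gamma> * t mod q)"

definition mcrt_char_set :: "nat \<Rightarrow> nat \<Rightarrow> nat \<Rightarrow> (nat \<times> nat) set" where
  "mcrt_char_set p q g = {(g * t mod p, t) | t. 0 \<le> t \<and> t < q}"

definition mcrt_seq :: "nat \<Rightarrow> nat \<Rightarrow> nat \<Rightarrow> nat \<Rightarrow> nat \<Rightarrow> nat" where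
  "mcrt_seq p q \<gamma> g t = (if mcrt_map p q \<gamma> t \<in> mcrt_char_set p q g then 1 else 0)"

definition has_period :: "(nat \<Rightarrow> 'b) \<Rightarrow> nat \<Rightarrow> bool" where
  "has_period s n \<longleftrightarrow> 0 < n \<and> (\<forall>t. s (t + n) = s t)"

section \<open>The collision channel without feedback\<close>

text \<open>Silence, collision and content are distinct outcomes, so a packet whose content happens to be
  the zero symbol is not confused with an idle slot.\<close>

datatype 'a channel_symbol = Idle | Collision | Received 'a

definition collision_channel ::
  "nat set \<Rightarrow> (nat \<Rightarrow> nat \<Rightarrow> 'a option) \<Rightarrow> nat \<Rightarrow> 'a channel_symbol" where
  "collision_channel A x t =
     (let T = {g \<in> A. x g t \<noteq> None} in
      if T = {} then Idle
      else if is_singleton T then Received (the (x (the_elem T) t))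
      else Collision)"

text \<open>A user with protocol sequence \<open>s\<close> and delay offset \<open>d\<close> starts its sequence in slot \<open>d\<close> and is
  silent before that. From slot \<open>d\<close> on it runs through consecutive frames of \<open>L\<close> slots. In the \<open>j\<close>-th
  frame it conveys the information word \<open>u j\<close>: the packet sent in the \<open>n\<close>-th slot of that frame
  (\<open>n < L\<close>, \<open>s n = 1\<close>) is \<open>e (u j) n\<close>, which depends on nothing but the word of that frame.\<close>

definition user_signal ::
  "(nat \<Rightarrow> nat) \<Rightarrow> nat \<Rightarrow> ('a list \<Rightarrow> nat \<Rightarrow> 'a) \<Rightarrow> nat \<Rightarrow> (nat \<Rightarrow> 'a list) \<Rightarrow> nat \<Rightarrow> 'a option" where
  "user_signal s L e d u t =
     (if d \<le> t \<and> s (t - d) = 1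
      then Some (e (u ((t - d) div L)) ((t - d) mod L))
      else None)"

definition info_words :: "'a set \<Rightarrow> nat \<Rightarrow> 'a list set" where
  "info_words Q D = {w. set w \<subseteq> Q \<and> length w = D}"

text \<open>The encoders \<open>enc g\<close> and the decoder \<open>dec\<close> are fixed in advance; the decoder sees the channel
  output only, so it knows neither the set \<open>A\<close> of active users nor their offsets. It returns the
  stream of information words for every active user and \<open>None\<close> for every other one.\<close>

definition each_active_user_can_send ::
  "(nat \<Rightarrow> nat \<Rightarrow> nat) \<Rightarrow> nat \<Rightarrow> nat set \<Rightarrow> nat \<Rightarrow> 'a set \<Rightarrow> nat \<Rightarrow> bool" where
  "each_active_user_can_send s L U m Q D \<longleftrightarrow>
     (\<exists>(enc :: nat \<Rightarrow> 'a list \<Rightarrow> nat \<Rightarrow> 'a)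
       (dec :: (nat \<Rightarrow> 'a channel_symbol) \<Rightarrow> nat \<Rightarrow> (nat \<Rightarrow> 'a list) option).
        (\<forall>g\<in>U. \<forall>w\<in>info_words Q D. \<forall>n<L. s g n = 1 \<longrightarrow> enc g w n \<in> Q) \<and>
        (\<forall>A (d :: nat \<Rightarrow> nat) (u :: nat \<Rightarrow> nat \<Rightarrow> 'a list).
           A \<subseteq> U \<longrightarrow> card A = m \<longrightarrow> (\<forall>g\<in>A. \<forall>j. u g j \<in> info_words Q D) \<longrightarrow>
           dec (collision_channel A (\<lambda>g. user_signal (s g) L (enc g) (d g) (u g)))
             = (\<lambda>g. if g \<in> A then Some (u g) else None)))"

definition system_throughput :: "nat \<Rightarrow> nat \<Rightarrow> nat \<Rightarrow> real" where
  "system_throughput m D L = real (m * D) / real L"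

definition achieves_throughput ::
  "(nat \<Rightarrow> nat \<Rightarrow> nat) \<Rightarrow> nat \<Rightarrow> nat set \<Rightarrow> nat \<Rightarrow> 'a set \<Rightarrow> real \<Rightarrow> bool" where
  "achieves_throughput s L U m Q R \<longleftrightarrow>
     (\<exists>D. each_active_user_can_send s L U m Q D \<and> R = system_throughput m D L)"

section \<open>The number of information packets per period\<close>

text \<open>Both the truncated subtraction and the division are exact for odd \<open>p\<close> and \<open>k \<ge> 1\<close>.\<close>

definition info_packets :: "nat \<Rightarrow> nat \<Rightarrow> nat" where
  "info_packets p k = (k * p + k - p + 3) div 2"

lemma info_packets_real:
  assumes "odd p" and "1 \<le> k"
  shows "real (info_packets p k) = 1/2 * (real k * real p + real k - real p + 3)"
proof -
  have le: "p \<le> k * p + k" using \<open>1 \<le> k\<close> by (simp add: trans_le_add1)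
  have ev: "even (k * p + k - p + 3)" using \<open>odd p\<close> le by (auto simp: even_diff_nat)
  have "2 * info_packets p k = k * p + k - p + 3"
    unfolding info_packets_def using ev by simp
  then have "2 * real (info_packets p k) = real (k * p + k - p + 3)"
    by (metis of_nat_mult of_nat_numeral)
  also have "\<dots> = real k * real p + real k - real p + 3" using le by (simp add: of_nat_diff)
  finally show ?thesis by simp
qed

end

theory Submission
  imports "HOL-Algebra.Algebraic_Closure" Defs
begin

text \<open>Let \<open>q = k * p + 1\<close>. A packet of user \<open>g\<close> in slot \<open>t\<close> of its frame is indexed by \<open>n = \<gamma> * t mod q\<close>; each
  \<open>n < q\<close> occurs once, with \<open>t = g * n\<close> modulo \<open>p\<close>. For two different users the indices of the common
  slots fill at most one residue class modulo \<open>p\<close> before the wrap-around of the second user and one after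
  it, which gives at most \<open>k + 1\<close> collisions per frame. So every frame of an active user contains at least
  \<open>q - (p - 1) / 2 * (k + 1) = D(p, k)\<close> clean slots, and a Reed-Solomon code over a field with \<open>card Q\<close>
  elements recovers the information word once the active users and their delays are known.

  These can be read off the pattern of idle slots and collisions. An inactive user cannot be simulated,
  because \<open>(p + 1) / 2 * (k + 1) < q\<close>. The \<open>(p - 1) / 2\<close> interferers of a user \<open>g\<close> meet it in at most
  \<open>p - 1\<close> residues modulo \<open>p\<close>, so in some residue \<open>g\<close> itself must explain its packets under another
  delay; this forces the delay to change by exactly \<open>q - p * j\<close> slots with \<open>g * j = - 1\<close> modulo \<open>p\<close> and
  \<open>0 < j < p\<close>. For the earliest user whose delay changes, the packets with the last \<open>j\<close> indices are lost
  in every frame, and so are the packets sent before the new start, which meet at least \<open>p - j\<close> residues.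
  Counted with weights, the interferers can make up for at most \<open>p - 1\<close> of these \<open>p\<close> losses.\<close>

hide_const (open) Divisibility.prime

section \<open>Finite fields and maximum distance separable codes\<close>

text \<open>Induction by Pascal's rule: the factor \<open>x\<close> turns the \<open>i\<close>-th
  term into a multiple of \<open>T (Suc i)\<close>, the factor \<open>y\<close> into a multiple of
  \<open>T i\<close>.\<close>

lemma (in cring) binomial_cring:
  assumes x: "x \<in> carrier R" and y: "y \<in> carrier R"
  shows "(x \<oplus> y) [^] (n::nat) = (\<Oplus>i\<in>{..n}. [(n choose i)] \<cdot> (x [^] i \<otimes> y [^] (n - i)))"
proof (induction n)
  case 0
  show ?case using x y by simp
next
  case (Suc n)
  define T where "T i = x [^] i \<otimes> y [^] (Suc n - i)" for i
  have T: "T i \<in> carrier R" for i using x y by (simp add: T_def)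
  let ?S = "\<Oplus>i\<in>{..n}. [(n choose i)] \<cdot> (x [^] i \<otimes> y [^] (n - i))"
  have S: "?S \<in> carrier R" using x y by (intro finsum_closed) auto
  have Sx: "?S \<otimes> x = (\<Oplus>i\<in>{..n}. [(n choose i)] \<cdot> T (Suc i))"
  proof -
    have "?S \<otimes> x = (\<Oplus>i\<in>{..n}. [(n choose i)] \<cdot> (x [^] i \<otimes> y [^] (n - i)) \<otimes> x)"
      using x y by (intro finsum_ldistr) auto
    also have "\<dots> = (\<Oplus>i\<in>{..n}. [(n choose i)] \<cdot> T (Suc i))"
      using x y by (intro finsum_cong') (auto simp: T_def add_pow_ldistr add_pow_rdistr m_ac)
    finally show ?thesis .
  qed
  have Sy: "?S \<otimes> y = T 0 \<oplus> (\<Oplus>i\<in>{..n}. [(n choose Suc i)] \<cdot> T (Suc i))"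
  proof -
    have "?S \<otimes> y = (\<Oplus>i\<in>{..n}. [(n choose i)] \<cdot> (x [^] i \<otimes> y [^] (n - i)) \<otimes> y)"
      using x y by (intro finsum_ldistr) auto
    also have "\<dots> = (\<Oplus>i\<in>{..n}. [(n choose i)] \<cdot> T i)"
      using x y by (intro finsum_cong') (auto simp: T_def add_pow_ldistr m_assoc Suc_diff_le)
    \<comment> \<open>The added top term is zero since \<open>n choose Suc n\<close> is; splitting
      off index 0 then aligns this sum with the one in \<open>Sx\<close>.\<close>
    also have "\<dots> = (\<Oplus>i\<in>{..Suc n}. [(n choose i)] \<cdot> T i)"
      using T by (simp add: finsum_Suc binomial_eq_0)
    also have "\<dots> = T 0 \<oplus> (\<Oplus>i\<in>{..n}. [(n choose Suc i)] \<cdot> T (Suc i))"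
      using T by (subst finsum_Suc2) (auto intro!: a_comm finsum_closed)
    finally show ?thesis .
  qed
  have "(x \<oplus> y) [^] Suc n = ?S \<otimes> x \<oplus> ?S \<otimes> y"
    using Suc.IH x y S by (simp add: r_distr)
  also have "\<dots> = T 0 \<oplus> ((\<Oplus>i\<in>{..n}. [(n choose i)] \<cdot> T (Suc i)) \<oplus> (\<Oplus>i\<in>{..n}. [(n choose Suc i)] \<cdot> T (Suc i)))"
    unfolding Sx Sy using T by (intro a_lcomm) (auto intro!: finsum_closed)
  also have "(\<Oplus>i\<in>{..n}. [(n choose i)] \<cdot> T (Suc i)) \<oplus> (\<Oplus>i\<in>{..n}. [(n choose Suc i)] \<cdot> T (Suc i))
       = (\<Oplus>i\<in>{..n}. [(n choose i)] \<cdot> T (Suc i) \<oplus> [(n choose Suc i)] \<cdot> T (Suc i))"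
    using T by (intro finsum_addf[symmetric]) auto
  also have "\<dots> = (\<Oplus>i\<in>{..n}. [(Suc n choose Suc i)] \<cdot> T (Suc i))"
    using T by (intro finsum_cong') (auto simp: add.nat_pow_mult)
  also have "T 0 \<oplus> \<dots> = (\<Oplus>i\<in>{..Suc n}. [(Suc n choose i)] \<cdot> T i)"
    using T by (subst finsum_Suc2) (auto intro!: a_comm finsum_closed)
  finally show ?case by (simp add: T_def)
qed

text \<open>The inner binomial coefficients of a prime exponent are divisible by \<open>P\<close>
  and vanish in characteristic \<open>P\<close>; the exponent \<open>P ^ n\<close> follows by
  iteration.\<close>

lemma (in cring) frobenius_add:
  assumes P: "prime P" "[(P::nat)] \<cdot> \<one> = \<zero>" and x: "x \<in> carrier R" and y: "y \<in> carrier R"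
  shows "(x \<oplus> y) [^] P ^ n = x [^] P ^ n \<oplus> y [^] P ^ n"
proof -
  have char: "[m] \<cdot> a = \<zero>" if "P dvd m" "a \<in> carrier R" for m :: nat and a
  proof -
    from \<open>P dvd m\<close> obtain c where m: "m = P * c" by (elim dvdE)
    have "[m] \<cdot> a = [P] \<cdot> ([c] \<cdot> a)" using that(2) m by (simp add: add.nat_pow_pow mult.commute)
    also have "\<dots> = ([P] \<cdot> \<one>) \<otimes> ([c] \<cdot> a)" using that(2) by (simp add: add_pow_ldistr)
    finally show ?thesis using P(2) that(2) by simp
  qed
  have one: "(x \<oplus> y) [^] P = x [^] P \<oplus> y [^] P" if x: "x \<in> carrier R" and y: "y \<in> carrier R" for x y
  proof -
    let ?f = "\<lambda>i. [(P choose i)] \<cdot> (x [^] i \<otimes> y [^] (P - i))"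
    have P0: "P > 0" using P(1) prime_gt_0_nat by blast
    have "(x \<oplus> y) [^] P = (\<Oplus>i\<in>{..P}. ?f i)" by (rule binomial_cring[OF x y])
    also have "\<dots> = (\<Oplus>i\<in>{0,P}. ?f i)"
    proof (rule add.finprod_mono_neutral_cong_right)
      show "?f i = \<zero>" if "i \<in> {..P} - {0, P}" for i
        using that x y P(1) by (auto intro!: char dvd_choose_prime)
    qed (use x y in auto)
    also have "\<dots> = x [^] P \<oplus> y [^] P"
      using x y P0 by (simp add: a_comm)
    finally show ?thesis .
  qed
  show ?thesis
  proof (induction n)
    case (Suc n)
    have "(x \<oplus> y) [^] P ^ Suc n = ((x \<oplus> y) [^] P ^ n) [^] P"
      using x y by (simp add: nat_pow_pow mult.commute)
    also have "\<dots> = x [^] P ^ Suc n \<oplus> y [^] P ^ Suc n"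
      using x y by (simp add: Suc.IH one nat_pow_pow mult.commute)
    finally show ?case .
  qed (use x y in simp)
qed

lemma (in cring) frobenius_minus:
  assumes P: "prime P" "[(P::nat)] \<cdot> \<one> = \<zero>" and x: "x \<in> carrier R" and y: "y \<in> carrier R"
  shows "(x \<ominus> y) [^] P ^ n = x [^] P ^ n \<ominus> y [^] P ^ n"
proof -
  have "x [^] P ^ n = ((x \<ominus> y) \<oplus> y) [^] P ^ n" using x y by algebra
  also have "\<dots> = (x \<ominus> y) [^] P ^ n \<oplus> y [^] P ^ n"
    using x y by (intro frobenius_add[OF P]) auto
  finally have *: "x [^] P ^ n = (x \<ominus> y) [^] P ^ n \<oplus> y [^] P ^ n" .
  have c: "(x \<ominus> y) [^] P ^ n \<in> carrier R" "y [^] P ^ n \<in> carrier R" using x y by auto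
  show ?thesis unfolding * using c by algebra
qed

section \<open>Roots of \<open>X^(P^n) - X\<close> in characteristic \<open>P\<close>\<close>

context algebraically_closed
begin

text \<open>No derivatives are used: the Frobenius power is additive and fixes \<open>a\<close>, so
  \<open>f = l^N - l\<close> for the linear factor \<open>l = X - a\<close>, and the cofactor
  \<open>l^(N-1) - 1\<close> takes the value -1 at \<open>a\<close>.\<close>

lemma count_frobenius_roots:
  assumes P: "prime P" "[(P::nat)] \<cdot> \<one> = \<zero>" and n: "n > 0"
  defines "f \<equiv> (X [^]\<^bsub>poly_ring L\<^esub> (P ^ n)) \<ominus>\<^bsub>poly_ring L\<^esub> X"
  assumes a: "a \<in> carrier L" "a [^] P ^ n = a"
  shows "alg_mult f a \<le> 1"
proof -
  interpret UP: domain "poly_ring L"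
    using univ_poly_is_domain[OF carrier_is_subring] .
  have X: "X \<in> carrier (poly_ring L)" by (rule var_closed(1)[OF carrier_is_subring])
  have N1: "P ^ n > 1" using P(1) n by (metis one_less_power prime_gt_1_nat)
  define N where "N = P ^ n"
  define c where "c = poly_of_const a"
  define l where "l = [\<one>, \<ominus> a]"
  have hom: "poly_of_const \<in> ring_hom L (poly_ring L)"
    using canonical_embedding_is_hom[OF carrier_is_subring] by simp
  interpret C: ring_hom_ring L "poly_ring L" poly_of_const
    by (rule ring_hom_ringI2[OF ring_axioms UP.ring_axioms hom])
  interpret E: ring_hom_ring "poly_ring L" L "\<lambda>p. eval p a"
    by (rule eval_ring_hom[OF carrier_is_subring a(1)])
  have c: "c \<in> carrier (poly_ring L)" unfolding c_def using a(1) by simp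
  have l: "l \<in> carrier (poly_ring L)" unfolding l_def univ_poly_carrier[symmetric] polynomial_def
    using a(1) by auto
  have lX: "l = X \<ominus>\<^bsub>poly_ring L\<^esub> c"
    using a(1) univ_poly_a_inv_def'[OF carrier_is_subring c]
    by (auto simp: l_def c_def a_minus_def poly_of_const_def var_def univ_poly_add)
  have "[m] \<cdot>\<^bsub>poly_ring L\<^esub> \<one>\<^bsub>poly_ring L\<^esub> = poly_of_const ([m] \<cdot> \<one>)" for m :: nat
    by (induction m) simp_all
  from this[of P]
  have charUP: "[P] \<cdot>\<^bsub>poly_ring L\<^esub> \<one>\<^bsub>poly_ring L\<^esub> = \<zero>\<^bsub>poly_ring L\<^esub>"
    using P(2) by simp
  have cN: "c [^]\<^bsub>poly_ring L\<^esub> N = c"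
    using C.hom_nat_pow[OF a(1), of N] a(2) by (simp add: c_def N_def)
  have lN: "l [^]\<^bsub>poly_ring L\<^esub> N = X [^]\<^bsub>poly_ring L\<^esub> N \<ominus>\<^bsub>poly_ring L\<^esub> c"
    unfolding lX N_def using UP.frobenius_minus[OF P(1) charUP X c, of n] cN by (simp add: N_def)
  have f: "f = l [^]\<^bsub>poly_ring L\<^esub> N \<ominus>\<^bsub>poly_ring L\<^esub> l"
    unfolding lN unfolding lX f_def N_def[symmetric] using X c UP.nat_pow_closed[OF X, of N] by algebra
  define h where "h = l [^]\<^bsub>poly_ring L\<^esub> (N - 1) \<ominus>\<^bsub>poly_ring L\<^esub> \<one>\<^bsub>poly_ring L\<^esub>"
  have h: "h \<in> carrier (poly_ring L)" unfolding h_def using l by simp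
  have "l [^]\<^bsub>poly_ring L\<^esub> N = l \<otimes>\<^bsub>poly_ring L\<^esub> l [^]\<^bsub>poly_ring L\<^esub> (N - 1)"
    using UP.nat_pow_Suc2[OF l, of "N - 1"] N1 by (metis N_def Suc_diff_1 less_trans zero_less_one)
  then have f2: "f = l \<otimes>\<^bsub>poly_ring L\<^esub> h"
    unfolding f h_def using l UP.nat_pow_closed[OF l, of "N - 1"] by (simp add: a_minus_def UP.r_distr UP.r_minus)
  have eval_l: "eval l a = \<zero>" using a(1) by (simp add: l_def r_neg)
  have eval_h: "eval h a = \<ominus> \<one>"
  proof -
    have "eval h a = (eval l a) [^] (N - 1) \<ominus> \<one>"
      unfolding h_def using l by (simp add: a_minus_def E.hom_nat_pow del: eval.simps)
    also have "\<dots> = \<ominus> \<one>" using N1 by (simp add: eval_l a_minus_def N_def nat_pow_zero)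
    finally show ?thesis .
  qed
  have l0: "l \<noteq> \<zero>\<^bsub>poly_ring L\<^esub>" by (simp add: l_def univ_poly_zero)
  have f_car: "f \<in> carrier (poly_ring L)" unfolding f2 using l h by simp
  show ?thesis
  proof (rule ccontr)
    assume "\<not> alg_mult f a \<le> 1"
    then have "2 \<le> alg_mult f a" by simp
    then have "([\<one>, \<ominus> a] [^]\<^bsub>poly_ring L\<^esub> (2::nat)) pdivides f"
      by (rule le_alg_mult_imp_pdivides[OF a(1) f_car])
    then obtain g where g: "g \<in> carrier (poly_ring L)" "f = (l \<otimes>\<^bsub>poly_ring L\<^esub> l) \<otimes>\<^bsub>poly_ring L\<^esub> g"
      using l by (auto simp: pdivides_def factor_def l_def[symmetric] numeral_2_eq_2)
    then have "h = l \<otimes>\<^bsub>poly_ring L\<^esub> g"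
      using f2 l h l0 UP.m_assoc UP.m_lcancel[OF l0 l h] by simp
    then have "eval h a = eval l a \<otimes> eval g a" using l g(1) by (simp del: eval.simps)
    then show False using eval_h eval_l g(1) a(1) E.hom_closed[OF g(1)] by simp
  qed
qed

text \<open>The fixed points are the roots of a polynomial of degree \<open>P ^ n\<close> that
  splits into simple linear factors. They form the finite field over which the code is
  built.\<close>

lemma card_frobenius_fixed:
  assumes P: "prime P" "[(P::nat)] \<cdot> \<one> = \<zero>" and n: "n > 0"
  shows "card {a \<in> carrier L. a [^] P ^ n = a} = P ^ n"
proof -
  define f where "f = (X [^]\<^bsub>poly_ring L\<^esub> (P ^ n)) \<ominus>\<^bsub>poly_ring L\<^esub> X"
  interpret UP: domain "poly_ring L"
    using univ_poly_is_domain[OF carrier_is_subring] .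
  have X: "X \<in> carrier (poly_ring L)" by (rule var_closed(1)[OF carrier_is_subring])
  have N1: "P ^ n > 1" using P(1) n by (metis one_less_power prime_gt_1_nat)
  have Xn: "X [^]\<^bsub>poly_ring L\<^esub> (P ^ n) \<in> carrier (poly_ring L)" using X by simp
  have mX: "\<ominus>\<^bsub>poly_ring L\<^esub> X \<in> carrier (poly_ring L)" using X by simp
  have f: "f \<in> carrier (poly_ring L)" unfolding f_def using X by simp
  have dX: "length X - 1 = 1" by (simp add: var_def)
  have d1: "length (X [^]\<^bsub>poly_ring L\<^esub> (P ^ n)) - 1 = P ^ n"
    using polynomial_pow_degree[OF X, of "P ^ n"] dX by simp
  have d2: "length (\<ominus>\<^bsub>poly_ring L\<^esub> X) - 1 = 1"
    using univ_poly_a_inv_degree[OF carrier_is_subring X] dX by simp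
  have deg: "length f - 1 = P ^ n"
    unfolding f_def a_minus_def univ_poly_add
    using poly_add_degree_eq[OF carrier_is_subring, of "X [^]\<^bsub>poly_ring L\<^esub> (P ^ n)" "\<ominus>\<^bsub>poly_ring L\<^esub> X"]
      Xn mX d1 d2 N1 n prime_gt_1_nat[OF P(1)] by (simp add: univ_poly_carrier del: poly_add.simps)
  have f0: "f \<noteq> []" using deg N1 by (auto simp: zero_power)
  have root: "is_root f a \<longleftrightarrow> a \<in> carrier L \<and> a [^] P ^ n = a" for a
  proof (cases "a \<in> carrier L")
    case True
    interpret E: ring_hom_ring "poly_ring L" L "\<lambda>p. eval p a"
      by (rule eval_ring_hom[OF carrier_is_subring True])
    have "eval f a = a [^] P ^ n \<ominus> a"
      unfolding f_def using X Xn mX True by (simp add: a_minus_def E.hom_nat_pow eval_var del: eval.simps)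
    then show ?thesis using True f0 by (auto simp: is_root_def r_right_minus_eq)
  qed (simp add: is_root_def)
  have set: "set_mset (roots f) = {a \<in> carrier L. a [^] P ^ n = a}"
    using roots_mem_iff_is_root[OF f] root by auto
  have count: "count (roots f) a = 1" if "a \<in># roots f" for a
  proof -
    have "alg_mult f a \<le> 1"
      unfolding f_def using that set by (intro count_frobenius_roots[OF P n]) auto
    then have "count (roots f) a \<le> 1" using alg_mult_eq_count_roots[OF f] by simp
    then show ?thesis using that count_greater_zero_iff[of "roots f" a] by linarith
  qed
  have "P ^ n = size (roots f)"
    using roots_over_carrier[OF f] deg unfolding splitted_def by simp
  also have "\<dots> = (\<Sum>a\<in>set_mset (roots f). count (roots f) a)" by (simp add: size_multiset_overloaded_eq)
  also have "\<dots> = card (set_mset (roots f))" using count by simp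
  finally show ?thesis using set by simp
qed

end

section \<open>Polynomial evaluation and Reed-Solomon codes\<close>

lemma (in ring) eval_map2_minus:
  assumes "set v \<subseteq> carrier R" "set w \<subseteq> carrier R" "length v = length w" "x \<in> carrier R"
  shows "eval (map2 (\<lambda>a b. a \<ominus> b) v w) x = eval v x \<ominus> eval w x"
  using assms(3,1,2)
proof (induction v w rule: list_induct2)
  case (Cons a v b w)
  have c: "eval v x \<in> carrier R" "eval w x \<in> carrier R" "x [^] length w \<in> carrier R"
    using Cons.prems assms(4) by (auto intro: eval_in_carrier)
  have "(a \<ominus> b) \<otimes> x [^] length w \<oplus> (eval v x \<ominus> eval w x) =
     a \<otimes> x [^] length w \<oplus> eval v x \<ominus> (b \<otimes> x [^] length w \<oplus> eval w x)"
    using Cons.prems c by (simp add: a_minus_def l_distr l_minus minus_add a_ac)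
  then show ?case using Cons by simp
qed (simp add: a_minus_def)

text \<open>The difference is a polynomial of degree below \<open>length v\<close> with at least
  \<open>length v\<close> roots, hence zero.\<close>

lemma (in field) eval_eq_imp_eq:
  assumes v: "set v \<subseteq> carrier R" and w: "set w \<subseteq> carrier R" and len: "length v = length w"
    and A: "A \<subseteq> carrier R" "finite A" "length v \<le> card A"
    and eq: "\<And>x. x \<in> A \<Longrightarrow> eval v x = eval w x"
  shows "v = w"
proof -
  define d where "d = map2 (\<lambda>a b. a \<ominus> b) v w"
  \<comment> \<open>\<open>d\<close> may begin with zeros; only the normalized list is an element of
    \<open>poly_ring R\<close>.\<close>
  define f where "f = normalize d"
  have d: "set d \<subseteq> carrier R"
    unfolding d_def using v w by (force dest: set_zip_leftD set_zip_rightD)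
  have f: "f \<in> carrier (poly_ring R)"
    unfolding f_def univ_poly_carrier[symmetric] by (rule normalize_gives_polynomial[OF d])
  have z: "eval f x = \<zero>" if "x \<in> A" for x
  proof -
    have x: "x \<in> carrier R" using that A(1) by auto
    have "eval f x = eval v x \<ominus> eval w x"
      unfolding f_def using eval_normalize[OF d x] eval_map2_minus[OF v w len x] by (simp add: d_def)
    then show ?thesis using eq[OF that] eval_in_carrier[OF w x] by (simp add: a_minus_def r_neg)
  qed
  have "f = []"
  proof (rule ccontr)
    assume f0: "f \<noteq> []"
    have "A \<subseteq> set_mset (roots f)"
      using z A(1) f0 roots_mem_iff_is_root[OF f] by (auto simp: is_root_def)
    then have "card A \<le> card (set_mset (roots f))" by (intro card_mono) auto
    also have "\<dots> \<le> size (roots f)" by (metis mset_set_set_mset_msubset size_mset_mono size_mset_set)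
    also have "\<dots> \<le> length f - 1" by (rule size_roots_le_degree[OF f])
    also have "\<dots> < length f" using f0 by (cases f) auto
    also have "\<dots> \<le> length d" unfolding f_def by (rule normalize_length_le)
    also have "\<dots> = length v" using len by (simp add: d_def)
    finally show False using A(3) by simp
  qed
  then have "d = replicate (length d) \<zero>"
    using normalize_def'[of d] unfolding f_def by simp
  then have "\<forall>i<length v. v ! i \<ominus> w ! i = \<zero>"
    using len by (metis (no_types, lifting) d_def length_map length_zip min.idem nth_map nth_replicate nth_zip prod.simps(2))
  then show ?thesis using v w len
    by (intro nth_equalityI) (auto simp: r_right_minus_eq subset_iff)
qed

text \<open>Obtained inside an algebraic closure of the integers modulo \<open>P\<close>; the
  closure construction dictates the type of \<open>L\<close>. The last property closes the fixed
  points under addition.\<close>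

lemma ex_frobenius_fixed_field:
  assumes P: "prime P" and n: "n > 0"
  obtains L :: "((int list \<times> nat) multiset \<Rightarrow> int) ring" where
    "field L" "card {a \<in> carrier L. a [^]\<^bsub>L\<^esub> P ^ n = a} = P ^ n"
    "\<And>x y. x \<in> carrier L \<Longrightarrow> y \<in> carrier L \<Longrightarrow> (x \<oplus>\<^bsub>L\<^esub> y) [^]\<^bsub>L\<^esub> P ^ n = x [^]\<^bsub>L\<^esub> P ^ n \<oplus>\<^bsub>L\<^esub> y [^]\<^bsub>L\<^esub> P ^ n"
proof -
  interpret Z: residues_prime P "residue_ring (int P)"
    using P by unfold_locales simp_all
  obtain L :: "((int list \<times> nat) multiset \<Rightarrow> int) ring" where
    L: "algebraic_closure L (Z.indexed_const ` carrier (residue_ring (int P)))"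
    and hom: "Z.indexed_const \<in> ring_hom (residue_ring (int P)) L"
    using Z.exists_closure by blast
  interpret L: algebraic_closure L "Z.indexed_const ` carrier (residue_ring (int P))" by (rule L)
  interpret H: ring_hom_ring "residue_ring (int P)" L Z.indexed_const
    by (rule ring_hom_ringI2[OF Z.ring_axioms L.ring_axioms hom])
  have "[m] \<cdot>\<^bsub>L\<^esub> \<one>\<^bsub>L\<^esub> = Z.indexed_const (int m mod int P)" for m
  proof (induction m)
    case 0
    show ?case using H.hom_zero by (simp add: Z.res_zero_eq)
  next
    case (Suc m)
    have "int m mod int P \<in> carrier (residue_ring (int P))" "1 \<in> carrier (residue_ring (int P))"
      using P prime_gt_1_nat[OF P] by (auto simp: Z.res_carrier_eq)
    then have "Z.indexed_const (int m mod int P) \<oplus>\<^bsub>L\<^esub> \<one>\<^bsub>L\<^esub> = Z.indexed_const ((int m mod int P + 1) mod int P)"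
      using H.hom_add[of "int m mod int P" 1] H.hom_one by (simp add: Z.res_one_eq Z.res_add_eq)
    then show ?case using Suc by (simp add: mod_simps add.commute)
  qed
  from this[of P] have char: "[P] \<cdot>\<^bsub>L\<^esub> \<one>\<^bsub>L\<^esub> = \<zero>\<^bsub>L\<^esub>"
    using H.hom_zero by (simp add: Z.res_zero_eq)
  show thesis
    by (rule that[OF L.field_axioms L.card_frobenius_fixed[OF P char n] L.frobenius_add[OF P char]])
qed

text \<open>A Reed-Solomon code: \<open>\<phi>\<close> identifies the alphabet with the field
  \<open>F\<close>, a word is the coefficient list of a polynomial, and its \<open>i\<close>-th
  symbol is the value at the point \<open>\<psi> i\<close>.\<close>

lemma ex_mds_code:
  fixes Q :: "'a set"
  assumes Q: "primepow (card Q)" and n: "n \<le> card Q"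
  obtains c :: "'a list \<Rightarrow> nat \<Rightarrow> 'a" where
    "\<And>w i. w \<in> info_words Q D \<Longrightarrow> i < n \<Longrightarrow> c w i \<in> Q"
    "\<And>w w' I. w \<in> info_words Q D \<Longrightarrow> w' \<in> info_words Q D \<Longrightarrow> I \<subseteq> {..<n} \<Longrightarrow> D \<le> card I \<Longrightarrow>
       (\<And>i. i \<in> I \<Longrightarrow> c w i = c w' i) \<Longrightarrow> w = w'"
proof -
  obtain P m where P: "prime P" "m > 0" "card Q = P ^ m"
    using Q unfolding primepow_def by blast
  obtain L :: "((int list \<times> nat) multiset \<Rightarrow> int) ring" where
    L: "field L" and cardF: "card {a \<in> carrier L. a [^]\<^bsub>L\<^esub> P ^ m = a} = P ^ m"
    and frob: "\<And>x y. x \<in> carrier L \<Longrightarrow> y \<in> carrier L \<Longrightarrow> (x \<oplus>\<^bsub>L\<^esub> y) [^]\<^bsub>L\<^esub> P ^ m = x [^]\<^bsub>L\<^esub> P ^ m \<oplus>\<^bsub>L\<^esub> y [^]\<^bsub>L\<^esub> P ^ m"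
    using ex_frobenius_fixed_field[OF P(1,2)] by blast
  interpret L: field L by (rule L)
  define F where "F = {a \<in> carrier L. a [^]\<^bsub>L\<^esub> P ^ m = a}"
  have P0: "P ^ m > 0" using P(1) prime_gt_0_nat by simp
  have FL: "F \<subseteq> carrier L" by (auto simp: F_def)
  have fin: "finite F" "finite Q" using cardF P(3) P0 F_def card_ge_0_finite by (metis, metis)
  have F0: "\<zero>\<^bsub>L\<^esub> \<in> F" using P0 by (simp add: F_def L.nat_pow_zero)
  have Fadd: "x \<oplus>\<^bsub>L\<^esub> y \<in> F" if "x \<in> F" "y \<in> F" for x y
    using that frob by (auto simp: F_def)
  have Fmult: "x \<otimes>\<^bsub>L\<^esub> y \<in> F" if "x \<in> F" "y \<in> F" for x y
    using that by (auto simp: F_def L.nat_pow_distrib)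
  have F1: "\<one>\<^bsub>L\<^esub> \<in> F" by (simp add: F_def)
  have Fpow: "x [^]\<^bsub>L\<^esub> (i::nat) \<in> F" if "x \<in> F" for x i
    by (induction i) (use that F1 Fmult in auto)
  have Feval: "L.eval v x \<in> F" if "set v \<subseteq> F" "x \<in> F" for v x
    using that by (induction v) (auto intro: F0 Fadd Fmult Fpow)
  obtain \<phi> where \<phi>: "bij_betw \<phi> Q F"
    using fin P(3) cardF F_def finite_same_card_bij by metis
  obtain \<psi> where \<psi>: "inj_on \<psi> {..<n}" "\<psi> ` {..<n} \<subseteq> F"
    using card_le_inj[of "{..<n}" F] fin n P(3) cardF by (auto simp: F_def)
  define c where "c w i = inv_into Q \<phi> (L.eval (map \<phi> w) (\<psi> i))" for w i
  have w: "set (map \<phi> w) \<subseteq> F" if "w \<in> info_words Q D" for w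
    using that bij_betw_imp_surj_on[OF \<phi>] by (auto simp: info_words_def)
  show thesis
  proof (rule that)
    fix w i assume "w \<in> info_words Q D" "i < n"
    then have "L.eval (map \<phi> w) (\<psi> i) \<in> F" using w \<psi>(2) by (intro Feval) auto
    then show "c w i \<in> Q" using bij_betw_imp_surj_on[OF \<phi>] by (simp add: c_def inv_into_into)
  next
    fix w w' I assume w1: "w \<in> info_words Q D" and w2: "w' \<in> info_words Q D" and I: "I \<subseteq> {..<n}" "D \<le> card I"
      and eq: "\<And>i. i \<in> I \<Longrightarrow> c w i = c w' i"
    have len: "length w = D" "length w' = D" using w1 w2 by (auto simp: info_words_def)
    have "map \<phi> w = map \<phi> w'"
    proof (rule L.eval_eq_imp_eq[where A = "\<psi> ` I"])
      show "set (map \<phi> w) \<subseteq> carrier L" "set (map \<phi> w') \<subseteq> carrier L" using w[OF w1] w[OF w2] FL by blast+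
      show "\<psi> ` I \<subseteq> carrier L" using \<psi>(2) I(1) FL by blast
      show "finite (\<psi> ` I)" using I(1) finite_subset by blast
      show "length (map \<phi> w) \<le> card (\<psi> ` I)"
        using I(2) len card_image[OF inj_on_subset[OF \<psi>(1) I(1)]] by simp
      fix x assume "x \<in> \<psi> ` I"
      then obtain i where i: "i \<in> I" "x = \<psi> i" by auto
      then have "x \<in> F" using \<psi>(2) I(1) by blast
      then have "L.eval (map \<phi> w) x \<in> \<phi> ` Q" "L.eval (map \<phi> w') x \<in> \<phi> ` Q"
        using Feval w[OF w1] w[OF w2] bij_betw_imp_surj_on[OF \<phi>] by auto
      then show "L.eval (map \<phi> w) x = L.eval (map \<phi> w') x"
        using eq[OF i(1)] i(2) unfolding c_def by (metis f_inv_into_f)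
    qed (simp add: len)
    then show "w = w'"
      using w1 w2 bij_betw_imp_inj_on[OF \<phi>] inj_on_map_eq_map[of \<phi> w w']
      by (auto simp: info_words_def intro: inj_on_subset)
  qed
qed

section \<open>Modified CRT sequences and their cross-correlation\<close>

text \<open>Turns a congruence argument into a ring identity with explicit multipliers
  \<open>r\<close> and \<open>s\<close>.\<close>

lemma dvd_lincomb:
  fixes m a b c :: int
  assumes "m dvd a" "m dvd b" "c = r * a + s * b"
  shows "m dvd c"
  using assms by simp

text \<open>Members of one residue class have distinct quotients \<open>(x - a) div p\<close>. The
  bound says, with the denominator cleared, that there are at most the ceiling of
  \<open>(c - a) / p\<close> of them.\<close>

lemma card_residue_class:
  fixes a c p :: nat
  assumes S: "S \<subseteq> {a..<c}" and "a \<le> c" and p: "0 < p"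
    and cong: "\<And>x y. x \<in> S \<Longrightarrow> y \<in> S \<Longrightarrow> int p dvd int x - int y"
  shows "p * card S \<le> c - a + p - 1"
proof (cases "S = {}")
  case False
  then have ac: "a < c" using S by auto
  have "inj_on (\<lambda>x. (x - a) div p) S"
  proof (rule inj_onI)
    fix x y assume xy: "x \<in> S" "y \<in> S" "(x - a) div p = (y - a) div p"
    then have ge: "a \<le> x" "a \<le> y" using S by auto
    have "int p dvd int (x - a) - int (y - a)" using cong[OF xy(1,2)] ge by (simp add: of_nat_diff)
    then have "int ((x - a) mod p) = int ((y - a) mod p)"
      unfolding zmod_int by (rule mod_eq_dvd_iff[THEN iffD2])
    then have "x - a = y - a" using xy(3) by (metis div_mult_mod_eq of_nat_eq_iff)
    then show "x = y" using ge by simp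
  qed
  then have "card S = card ((\<lambda>x. (x - a) div p) ` S)" by (simp add: card_image)
  also have "\<dots> \<le> card {..(c - a - 1) div p}"
    using S by (intro card_mono) (fastforce intro!: div_le_mono)+
  finally have "card S \<le> (c - a - 1) div p + 1" by simp
  then have "p * card S \<le> p * ((c - a - 1) div p) + p" by (metis mult_le_mono2 distrib_left mult_1_right)
  also have "\<dots> \<le> (c - a - 1) + p" by (simp add: mult.commute div_times_less_eq_dividend)
  finally show ?thesis using ac by simp
qed simp

section \<open>Indices and transmission slots of a CRT sequence\<close>

locale mcrt =
  fixes p k q \<gamma> :: nat
  assumes prime_p: "prime p" and odd_p: "odd p" and p_le_k: "p \<le> k"
    and q_eq: "q = k * p + 1" and gamma: "[\<gamma> * p = 1] (mod q)"
begin

text \<open>The second CRT coordinate. As \<open>\<gamma>\<close> inverts \<open>p\<close>, it is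
  the unique \<open>n < q\<close> with \<open>p * n = t\<close> modulo \<open>q\<close>.\<close>

definition idx :: "nat \<Rightarrow> nat" where
  "idx t = \<gamma> * t mod q"

text \<open>The condition for \<open>mcrt_seq\<close> to be 1 (see \<open>mcrt_seq_eq_1\<close>), as
  a congruence of integers so that slots can be subtracted freely.\<close>

definition hit :: "nat \<Rightarrow> nat \<Rightarrow> bool" where
  "hit g t \<longleftrightarrow> [int t = int g * int (idx t)] (mod int p)"

definition act :: "nat \<Rightarrow> nat \<Rightarrow> nat \<Rightarrow> bool" where
  "act g d T \<longleftrightarrow> d \<le> T \<and> hit g (T - d)"

lemma p_ge_3: "3 \<le> p"
  using prime_p odd_p prime_ge_2_nat[of p] by (cases "p = 2") auto

text \<open>Keeps \<open>p * j\<close> with \<open>j \<le> p\<close> below \<open>q\<close>, so that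
  congruences modulo \<open>q\<close> between such products and slots below \<open>q\<close> become
  equalities.\<close>

lemma q_gt: "p * p < q"
  using mult_le_mono1[OF p_le_k, of p] unfolding q_eq by linarith

lemma q_gt_p: "p < q"
  using q_gt p_ge_3 by (meson le_less_trans le_square)

lemma q_pos: "0 < q"
  by (simp add: q_eq)

lemma idx_less: "idx t < q"
  unfolding idx_def using q_pos by simp

lemma q_dvd_gamma: "int q dvd int \<gamma> * int p - 1"
proof -
  have "[int (\<gamma> * p) = int 1] (mod int q)" using gamma by (simp only: cong_int_iff)
  then show ?thesis by (simp add: cong_iff_dvd_diff)
qed

lemma q_dvd_cancel: "int q dvd int p * x \<Longrightarrow> int q dvd x"
  by (rule dvd_lincomb[of _ "int p * x" "int \<gamma> * int p - 1" _ "int \<gamma>" "- x"])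
    (simp_all add: q_dvd_gamma algebra_simps)

lemma idx_dvd: "int q dvd int p * int (idx t) - int t"
proof -
  have "int q dvd int (idx t) - int \<gamma> * int t"
    by (rule mod_eq_dvd_iff[THEN iffD1]) (simp add: idx_def zmod_int)
  then show ?thesis
    by (rule dvd_lincomb[OF _ q_dvd_gamma, of _ _ "int p" "int t"]) (simp add: algebra_simps)
qed

lemma dvd_small_eq:
  fixes x y :: int
  assumes "int q dvd x - y" "0 \<le> x" "x < int q" "0 \<le> y" "y < int q"
  shows "x = y"
  using mod_eq_dvd_iff[THEN iffD2, OF assms(1)] assms(2-5) by simp

lemma idx_unique:
  assumes "n < q" "int q dvd int p * int n - int t"
  shows "idx t = n"
proof -
  have "int q dvd (int p * int (idx t) - int t) - (int p * int n - int t)"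
    using idx_dvd assms(2) by (rule dvd_diff)
  then have "int q dvd int p * (int (idx t) - int n)" by (simp add: algebra_simps)
  then have "int q dvd int (idx t) - int n" by (rule q_dvd_cancel)
  then show ?thesis using dvd_small_eq[of "int (idx t)" "int n"] idx_less[of t] assms(1) by simp
qed

lemma coprime_p_q: "coprime p q"
proof (rule coprimeI)
  fix c assume "c dvd p" "c dvd q"
  then have "c dvd k * p" "c dvd k * p + 1" by (simp_all add: q_eq)
  then show "is_unit c" by (metis dvd_add_right_iff)
qed

text \<open>Hence a wrap-around of an index by \<open>q\<close> changes its residue modulo
  \<open>p\<close> by one.\<close>

lemma p_dvd_q: "int p dvd int q - 1"
  by (simp add: q_eq)

lemma p_not_dvd: "0 < x \<Longrightarrow> x < int p \<Longrightarrow> \<not> int p dvd x"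
  by (simp add: zdvd_not_zless)

lemma prime_int_p: "prime (int p)"
  using prime_p by simp

lemma p_dvd_prod: "int p dvd x * y \<Longrightarrow> int p dvd x \<or> int p dvd y"
  using prime_int_p prime_dvd_mult_iff by blast

lemma hit_dvd: "hit g t \<longleftrightarrow> int p dvd int t - int g * int (idx t)"
  by (simp add: hit_def cong_iff_dvd_diff)

lemma mcrt_seq_eq_1: "mcrt_seq p q \<gamma> g t = 1 \<longleftrightarrow> hit g t"
proof -
  have "mcrt_seq p q \<gamma> g t = 1 \<longleftrightarrow> t mod p = g * idx t mod p"
    using idx_less[of t] by (auto simp: mcrt_seq_def mcrt_map_def mcrt_char_set_def idx_def)
  also have "\<dots> \<longleftrightarrow> hit g t"
    unfolding hit_def using cong_int_iff[of t "g * idx t" p] by (simp add: cong_def)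
  finally show ?thesis .
qed

lemma idx_period: "idx (t + p * q * m) = idx t"
proof -
  have "\<gamma> * (t + p * q * m) = \<gamma> * t + q * (\<gamma> * p * m)" by (simp add: algebra_simps)
  then show ?thesis by (simp add: idx_def)
qed

lemma hit_period: "hit g (t + p * q * m) \<longleftrightarrow> hit g t"
proof -
  have e: "int (t + p * q * m) - int g * int (idx t) = (int t - int g * int (idx t)) + int p * (int q * int m)"
    by simp
  show ?thesis unfolding hit_dvd idx_period e by (rule dvd_add_left_iff) simp
qed

text \<open>Chinese remaindering with \<open>g * n\<close> modulo \<open>p\<close> and
  \<open>p * n\<close> modulo \<open>q\<close>. With \<open>hit_idx_inj\<close> it makes
  \<open>idx\<close> a bijection from the transmission slots of one period onto the indices below
  \<open>q\<close>.\<close>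

lemma ex_hit:
  assumes "n < q"
  obtains t where "t < p * q" "hit g t" "idx t = n"
proof -
  obtain x where x: "[x = g * n] (mod p)" "[x = p * n] (mod q)"
    using binary_chinese_remainder_nat[OF coprime_p_q] by blast
  define t where "t = x mod (p * q)"
  have t1: "[t = g * n] (mod p)" and t2: "[t = p * n] (mod q)"
    unfolding t_def using x by (simp_all add: cong_def mod_mod_cancel)
  have i: "idx t = n"
  proof (rule idx_unique[OF assms])
    have "[int (p * n) = int t] (mod int q)" using t2 by (simp only: cong_int_iff cong_sym_eq)
    then show "int q dvd int p * int n - int t" by (simp add: cong_iff_dvd_diff)
  qed
  moreover have "hit g t"
    using t1 unfolding hit_def i of_nat_mult[symmetric] cong_int_iff .
  moreover have "t < p * q" using q_pos p_ge_3 by (simp add: t_def)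
  ultimately show thesis using that by blast
qed

lemma hit_idx_inj:
  assumes "hit g s" "hit g t" "idx s = idx t" "s < p * q" "t < p * q"
  shows "s = t"
proof -
  have c: "coprime (int p) (int q)"
    using coprime_p_q by simp
  have "int p dvd int s - int t"
    using dvd_diff[OF assms(1,2)[unfolded hit_dvd]] assms(3) by simp
  moreover have "int q dvd int s - int t"
    using dvd_diff[OF idx_dvd[of t] idx_dvd[of s]] assms(3) by simp
  ultimately have "int p * int q dvd int s - int t"
    using c by (simp add: divides_mult)
  then have "int s mod (int p * int q) = int t mod (int p * int q)" by (rule mod_eq_dvd_iff[THEN iffD2])
  then have "int (s mod (p * q)) = int (t mod (p * q))" by (simp add: zmod_int)
  then show ?thesis using assms(4,5) by simp
qed

text \<open>The amount, modulo \<open>q\<close>, by which the index under delay \<open>d\<close>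
  exceeds the index under delay \<open>d'\<close> in the same slot. Integers are used because either
  delay may be the larger one.\<close>

definition off :: "nat \<Rightarrow> nat \<Rightarrow> int" where
  "off d d' = int \<gamma> * (int d' - int d) mod int q"

lemma off_range: "0 \<le> off d d'" "off d d' < int q"
  using q_pos by (auto simp: off_def)

lemma off_dvd: "int q dvd int p * off d d' - (int d' - int d)"
proof -
  have "int q dvd off d d' - int \<gamma> * (int d' - int d)"
    by (rule mod_eq_dvd_iff[THEN iffD1]) (simp add: off_def)
  then show ?thesis
    by (rule dvd_lincomb[OF _ q_dvd_gamma, of _ _ "int p" "int d' - int d"]) (simp add: algebra_simps)
qed

lemma off_unique:
  assumes "int q dvd int p * x - (int d' - int d)" "0 \<le> x" "x < int q"
  shows "off d d' = x"
proof -
  have "int q dvd (int p * off d d' - (int d' - int d)) - (int p * x - (int d' - int d))"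
    using off_dvd assms(1) by (rule dvd_diff)
  then have "int q dvd int p * (off d d' - x)" by (simp add: algebra_simps)
  then have "int q dvd off d d' - x" by (rule q_dvd_cancel)
  then show ?thesis using dvd_small_eq off_range assms(2,3) by blast
qed

lemma idx_off:
  assumes "d \<le> T" "d' \<le> T"
  shows "int (idx (T - d')) = (if off d d' \<le> int (idx (T - d)) then int (idx (T - d)) - off d d'
           else int (idx (T - d)) - off d d' + int q)" (is "_ = ?r")
proof -
  have "int q dvd (int p * int (idx (T - d')) - int (T - d')) - (int p * int (idx (T - d)) - int (T - d))
      + (int p * off d d' - (int d' - int d))"
    by (rule dvd_add[OF dvd_diff[OF idx_dvd idx_dvd] off_dvd])
  also have "\<dots> = int p * (int (idx (T - d')) - int (idx (T - d)) + off d d')"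
    using assms by (simp add: algebra_simps of_nat_diff)
  finally have "int q dvd int (idx (T - d')) - int (idx (T - d)) + off d d'" by (rule q_dvd_cancel)
  then have "int q dvd int (idx (T - d')) - ?r"
    using dvd_diff[of "int q" "int (idx (T - d')) - int (idx (T - d)) + off d d'" "int q"]
    by (auto simp: algebra_simps)
  then show ?thesis using off_range[of d d'] idx_less[of "T - d"] idx_less[of "T - d'"]
    by (intro dvd_small_eq) (auto split: if_splits)
qed

text \<open>On the same side of the wrap-around both users see the same index difference. Combining
  the four hit conditions makes \<open>g - h\<close> times that difference divisible by the prime
  \<open>p\<close>, and \<open>g\<close> and \<open>h\<close> are distinct modulo
  \<open>p\<close>.\<close>

lemma hit_residue:
  assumes gh: "g \<in> {1..p - 1}" "h \<in> {1..p - 1}" "g \<noteq> h"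
    and T: "act g d T" "act h d' T" and S: "act g d S" "act h d' S"
    and side: "off d d' \<le> int (idx (T - d)) \<longleftrightarrow> off d d' \<le> int (idx (S - d))"
  shows "int p dvd int (idx (T - d)) - int (idx (S - d))"
proof -
  let ?n = "int (idx (T - d))" and ?m = "int (idx (S - d))"
  have le: "d \<le> T" "d' \<le> T" "d \<le> S" "d' \<le> S" using T S by (auto simp: act_def)
  have e: "int (idx (T - d')) - int (idx (S - d')) = ?n - ?m"
    using idx_off[OF le(1,2)] idx_off[OF le(3,4)] side by auto
  have "int p dvd ((int (T - d') - int h * int (idx (T - d'))) - (int (S - d') - int h * int (idx (S - d'))))
     - ((int (T - d) - int g * ?n) - (int (S - d) - int g * ?m))"
    by (intro dvd_diff[OF dvd_diff dvd_diff] hit_dvd[THEN iffD1]) (use T S in \<open>simp_all add: act_def\<close>)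
  also have "\<dots> = (int g - int h) * (?n - ?m) + int h * ((?n - ?m) - (int (idx (T - d')) - int (idx (S - d'))))"
    using le by (simp add: algebra_simps of_nat_diff)
  also have "\<dots> = (int g - int h) * (?n - ?m)" using e by simp
  finally have "int p dvd int g - int h \<or> int p dvd ?n - ?m" by (rule p_dvd_prod)
  moreover have "\<not> int p dvd int g - int h"
  proof
    assume "int p dvd int g - int h"
    then have "int p \<le> \<bar>int g - int h\<bar>" using gh(3) dvd_imp_le_int[of "int g - int h" "int p"] by simp
    then show False using gh(1,2) by auto
  qed
  ultimately show ?thesis by blast
qed

text \<open>One residue for each side of the wrap-around. As the delays are arbitrary,
  \<open>h\<close> may be taken from another configuration than \<open>g\<close>.\<close>

lemma card_residues_le_2:
  assumes gh: "g \<in> {1..p - 1}" "h \<in> {1..p - 1}" "g \<noteq> h"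
  shows "finite {idx (T - d) mod p | T. act g d T \<and> act h d' T}"
    "card {idx (T - d) mod p | T. act g d T \<and> act h d' T} \<le> 2"
proof -
  let ?S = "{idx (T - d) mod p | T. act g d T \<and> act h d' T}"
  let ?U = "\<lambda>b. {idx (T - d) mod p | T. act g d T \<and> act h d' T \<and> (off d d' \<le> int (idx (T - d)) \<longleftrightarrow> b)}"
  have one: "\<exists>x. ?U b \<subseteq> {x}" for b
  proof (cases "?U b = {}")
    case False
    then obtain T where T: "act g d T" "act h d' T" "off d d' \<le> int (idx (T - d)) \<longleftrightarrow> b" by auto
    have "idx (S - d) mod p = idx (T - d) mod p"
      if "act g d S" "act h d' S" "off d d' \<le> int (idx (S - d)) \<longleftrightarrow> b" for S
    proof -
      have "int p dvd int (idx (S - d)) - int (idx (T - d))"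
        using hit_residue[OF gh that(1,2) T(1,2)] that(3) T(3) by simp
      then have "int (idx (S - d) mod p) = int (idx (T - d) mod p)"
        unfolding zmod_int by (rule mod_eq_dvd_iff[THEN iffD2])
      then show ?thesis by simp
    qed
    then show ?thesis by blast
  qed auto
  obtain x where "?U True \<subseteq> {x}" using one[of True] by blast
  moreover obtain y where "?U False \<subseteq> {y}" using one[of False] by blast
  ultimately have sub: "?S \<subseteq> {x, y}" by auto
  then show "finite ?S" by (rule finite_subset) simp
  have "card ?S \<le> card {x, y}" using sub by (intro card_mono) auto
  also have "\<dots> \<le> 2" by (simp add: card_insert_if)
  finally show "card ?S \<le> 2" .
qed

section \<open>Frames and the cross-correlation bound\<close>

definition frame :: "nat \<Rightarrow> nat \<Rightarrow> nat set" where
  "frame d m = {d + p * q * m..<d + p * q * m + p * q}"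

lemma frame_act:
  assumes "T \<in> frame d m"
  shows "act g d T \<longleftrightarrow> hit g (T - (d + p * q * m))" "idx (T - d) = idx (T - (d + p * q * m))"
    "T - (d + p * q * m) < p * q"
proof -
  have "T - d = T - (d + p * q * m) + p * q * m" "d \<le> T" using assms by (auto simp: frame_def)
  then show "act g d T \<longleftrightarrow> hit g (T - (d + p * q * m))" "idx (T - d) = idx (T - (d + p * q * m))"
    by (metis act_def hit_period, metis idx_period)
  show "T - (d + p * q * m) < p * q" using assms by (auto simp: frame_def)
qed

lemma inj_on_frame: "inj_on (\<lambda>T. idx (T - d)) {T \<in> frame d m. act g d T}"
proof (rule inj_onI)
  fix S T assume ST: "S \<in> {T \<in> frame d m. act g d T}" "T \<in> {T \<in> frame d m. act g d T}"
    and eq: "idx (S - d) = idx (T - d)"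
  then have *: "S \<in> frame d m" "T \<in> frame d m" "act g d S" "act g d T" by auto
  have "S - (d + p * q * m) = T - (d + p * q * m)"
  proof (rule hit_idx_inj)
    show "hit g (S - (d + p * q * m))" by (rule frame_act(1)[OF *(1), THEN iffD1, OF *(3)])
    show "hit g (T - (d + p * q * m))" by (rule frame_act(1)[OF *(2), THEN iffD1, OF *(4)])
    show "idx (S - (d + p * q * m)) = idx (T - (d + p * q * m))"
      using eq unfolding frame_act(2)[OF *(1)] frame_act(2)[OF *(2)] .
  qed (rule frame_act(3)[OF *(1)], rule frame_act(3)[OF *(2)])
  moreover have "d + p * q * m \<le> S" "d + p * q * m \<le> T" using ST by (auto simp: frame_def)
  ultimately show "S = T" by simp
qed

lemma ex_frame:
  assumes "n < q"
  obtains T where "T \<in> frame d m" "act g d T" "idx (T - d) = n"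
proof -
  obtain t where t: "t < p * q" "hit g t" "idx t = n" using ex_hit[OF assms] by blast
  have "d + p * q * m + t \<in> frame d m" using t(1) by (simp add: frame_def)
  moreover have "act g d (d + p * q * m + t)" "idx (d + p * q * m + t - d) = n"
    using frame_act(1,2)[OF calculation] t by auto
  ultimately show thesis using that by blast
qed

lemma card_frame: "card {T \<in> frame d m. act g d T} = q"
proof -
  have "(\<lambda>T. idx (T - d)) ` {T \<in> frame d m. act g d T} = {..<q}"
  proof (rule Set.equalityI)
    show "{..<q} \<subseteq> (\<lambda>T. idx (T - d)) ` {T \<in> frame d m. act g d T}"
    proof
      fix n assume "n \<in> {..<q}"
      then obtain T where "T \<in> frame d m" "act g d T" "idx (T - d) = n" using ex_frame[of n d m g] by auto
      then show "n \<in> (\<lambda>T. idx (T - d)) ` {T \<in> frame d m. act g d T}" by blast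
    qed
  qed (use idx_less in auto)
  then show ?thesis using card_image[OF inj_on_frame[of d m g]] by simp
qed

text \<open>The indices of the common slots are split at the wrap-around index \<open>b\<close>;
  each part lies in an interval and in one residue class.\<close>

lemma cross_correlation:
  assumes gh: "g \<in> {1..p - 1}" "h \<in> {1..p - 1}" "g \<noteq> h"
  shows "card {T \<in> frame d m. act g d T \<and> act h d' T} \<le> k + 1"
proof -
  define b where "b = nat (off d d')"
  have b: "b \<le> q" "int b = off d d'" using off_range[of d d'] by (auto simp: b_def)
  let ?X = "{T \<in> frame d m. act g d T \<and> act h d' T}"
  define I where "I = (\<lambda>T. idx (T - d)) ` ?X"
  have card_I: "card I = card ?X"
    unfolding I_def by (rule card_image) (rule inj_on_subset[OF inj_on_frame[of d m g]], auto)
  have c: "int p dvd int x - int y" if xy: "x \<in> I" "y \<in> I" "b \<le> x \<longleftrightarrow> b \<le> y" for x y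
  proof -
    obtain S T where "S \<in> ?X" "x = idx (S - d)" "T \<in> ?X" "y = idx (T - d)"
      using xy(1,2) unfolding I_def by blast
    then show ?thesis
      using hit_residue[OF gh, of d S d' T] xy(3) unfolding b(2)[symmetric] of_nat_le_iff by simp
  qed
  have I: "I \<subseteq> {..<q}" using idx_less unfolding I_def by blast
  have "card I \<le> card (I \<inter> {b..<q} \<union> I \<inter> {0..<b})"
  proof (rule card_mono)
    show "I \<subseteq> I \<inter> {b..<q} \<union> I \<inter> {0..<b}" using I by auto
  qed auto
  also have "\<dots> \<le> card (I \<inter> {b..<q}) + card (I \<inter> {0..<b})" by (rule card_Un_le)
  finally have "p * card I \<le> p * (card (I \<inter> {b..<q}) + card (I \<inter> {0..<b}))"
    by (rule mult_le_mono2)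
  moreover have "p * card (I \<inter> {b..<q}) \<le> q - b + p - 1"
    by (rule card_residue_class) (use b(1) p_ge_3 c in auto)
  moreover have "p * card (I \<inter> {0..<b}) \<le> b - 0 + p - 1"
    by (rule card_residue_class) (use p_ge_3 c in auto)
  ultimately have "p * card I \<le> q - b + p - 1 + (b - 0 + p - 1)" by (simp only: add_mult_distrib2)
  \<comment> \<open>The sum is \<open>q + 2 * p - 2\<close>, which is
    \<open>p * (k + 2) - 1\<close>.\<close>
  also have "\<dots> < p * (k + 2)" using b(1) p_ge_3 by (simp add: q_eq algebra_simps)
  finally have "card I < k + 2" by (simp only: mult_less_cancel1)
  then show ?thesis using card_I by simp
qed

section \<open>Ambiguous delays of a single user\<close>

text \<open>Starting \<open>q - p * j\<close> slots later lowers the local slot number by 1 modulo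
  \<open>p\<close> and raises the index by \<open>j\<close>. As \<open>g * j\<close> is -1 modulo
  \<open>p\<close>, hits survive unless the index wraps. The equation is additive to avoid truncated
  subtraction.\<close>

definition shifted :: "nat \<Rightarrow> nat \<Rightarrow> nat \<Rightarrow> nat \<Rightarrow> bool" where
  "shifted g j d d' \<longleftrightarrow> d < d' \<and> 1 \<le> j \<and> j < p \<and> d' + p * j = d + q \<and> int p dvd int g * int j + 1"

text \<open>A slot \<open>t = p * s - y\<close> has index \<open>n = y * k + s\<close>, since
  \<open>p * n - t = q * y\<close>. The hit condition fixes \<open>y\<close> and the residue class
  then fixes \<open>s\<close> modulo \<open>p\<close>. In \<open>shiftedI\<close> the bound
  \<open>t < q\<close> limits the change of a delay.\<close>

lemma ex_early_hit:
  obtains t where "t < q" "hit g t" "[idx t = \<nu>] (mod p)"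
proof -
  define y where "y = nat ((- int g * int \<nu>) mod int p)"
  have y: "y < p" "int p dvd int y + int g * int \<nu>"
  proof -
    have "int y = (- int g * int \<nu>) mod int p" using p_ge_3 by (simp add: y_def)
    then show "int p dvd int y + int g * int \<nu>"
      using mod_eq_dvd_iff[of "int y" "int p" "- int g * int \<nu>"] by simp
    show "y < p" using p_ge_3 by (simp add: y_def nat_less_iff)
  qed
  \<comment> \<open>Subtracting 1 before the reduction and adding it afterwards puts
    \<open>s\<close> between 1 and \<open>p\<close>, so that \<open>p * s - y\<close> is not
    truncated.\<close>
  define s where "s = nat ((int \<nu> - int y * int k - 1) mod int p) + 1"
  have s: "1 \<le> s" "s \<le> p" "int p dvd int y * int k + int s - int \<nu>"
  proof -
    have e: "int s = (int \<nu> - int y * int k - 1) mod int p + 1" using p_ge_3 by (simp add: s_def)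
    then have "int p dvd int s - 1 - (int \<nu> - int y * int k - 1)"
      using mod_eq_dvd_iff[of "int s - 1" "int p" "int \<nu> - int y * int k - 1"] by simp
    then show "int p dvd int y * int k + int s - int \<nu>" by (simp add: algebra_simps)
    have "(int \<nu> - int y * int k - 1) mod int p < int p" using p_ge_3 by simp
    then show "s \<le> p" using e by simp
  qed (simp add: s_def)
  define n where "n = y * k + s"
  define t where "t = p * s - y"
  have yt: "y \<le> p * s" using y(1) s(1) by (metis le_trans less_imp_le mult.right_neutral mult_le_mono2)
  have "n \<le> (p - 1) * k + p" unfolding n_def using y(1) s(2) by (intro add_mono mult_le_mono1) auto
  also have "\<dots> < q" using p_le_k p_ge_3 by (cases p) (auto simp: q_eq algebra_simps)
  finally have n: "n < q" .
  have "t \<le> p * p" unfolding t_def using s(2) by (meson diff_le_self le_trans mult_le_mono2)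
  then have tq: "t < q" using q_gt by simp
  have "int p * int n - int t = int q * int y"
    using yt by (simp add: n_def t_def q_eq algebra_simps of_nat_diff)
  then have i: "idx t = n" using n by (intro idx_unique) auto
  have h: "hit g t"
  proof -
    have "int p dvd - (int y + int g * int \<nu>) - int g * (int y * int k + int s - int \<nu>)"
      by (rule dvd_lincomb[OF y(2) s(3), of _ "-1" "- int g"]) simp
    then have "int p dvd int t - int g * int n"
      by (rule dvd_lincomb[of _ _ "int p" _ 1 "int s"]) (use yt in \<open>simp_all add: n_def t_def algebra_simps of_nat_diff\<close>)
    then show ?thesis by (simp add: hit_dvd i)
  qed
  have "[idx t = \<nu>] (mod p)"
    unfolding i using s(3) by (metis (mono_tags) cong_iff_dvd_diff cong_int_iff n_def of_nat_add of_nat_mult)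
  then show thesis using that[OF tq h] by blast
qed

lemma user_not_dvd:
  assumes "g \<in> {1..p - 1}"
  shows "\<not> int p dvd int g"
proof (rule p_not_dvd)
  have "1 \<le> g" "g \<le> p - 1" using assms by auto
  then show "0 < int g" "int g < int p" using p_ge_3 by linarith+
qed

lemma early_idx:
  assumes "t < q" "idx t < p"
  shows "t = p * idx t"
proof -
  have "p * idx t \<le> p * p" using assms(2) by simp
  then have "p * idx t < q" using q_gt by linarith
  then have "int p * int (idx t) < int q" by (metis of_nat_less_iff of_nat_mult)
  then have "int p * int (idx t) = int t"
    using assms(1) by (intro dvd_small_eq[OF idx_dvd]) auto
  then show ?thesis by (metis of_nat_eq_iff of_nat_mult)
qed

text \<open>The mirror image of \<open>early_idx\<close>: an index \<open>q - a\<close> with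
  \<open>a \<le> j\<close> forces \<open>t = q - p * a\<close>.\<close>

lemma late_idx:
  assumes "t < q" "q \<le> idx t + j" "j < p"
  shows "q \<le> t + p * j"
proof -
  have "j < q" using assms(3) q_gt_p by simp
  define a where "a = q - idx t"
  have a: "int a = int q - int (idx t)" "1 \<le> a" "a \<le> j"
    using idx_less[of t] assms(2) by (auto simp: a_def of_nat_diff)
  have "p * a \<le> p * p" using a(3) assms(3) by simp
  then have "p * a < q" using q_gt by linarith
  then have pa: "int p * int a < int q" by (metis of_nat_less_iff of_nat_mult)
  have "int q dvd (int q - int p * int a) - int t"
    by (rule dvd_lincomb[OF idx_dvd[of t] dvd_refl, of _ 1 "1 - int p"]) (simp add: a algebra_simps)
  then have "int q - int p * int a = int t"
    using pa a(2) p_ge_3 assms(1) by (intro dvd_small_eq) auto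
  then have "q = t + p * a" by (metis add.commute diff_eq_eq of_nat_add of_nat_eq_iff of_nat_mult)
  then show ?thesis using a(3) by simp
qed

text \<open>Here \<open>t = p * idx t\<close>, so the hit condition makes \<open>g * idx t\<close>
  divisible by \<open>p\<close>, which a positive index below \<open>p\<close> excludes.\<close>

lemma early_hit_multiple:
  assumes "hit g t" "g \<in> {1..p - 1}" "t < q" "idx t < p"
  shows "t = 0"
proof -
  have t: "t = p * idx t" by (rule early_idx[OF assms(3,4)])
  then have "int p dvd int t" by (metis dvd_triv_left of_nat_mult)
  moreover have "int p dvd int t - int g * int (idx t)" using assms(1) by (simp add: hit_dvd)
  ultimately have "int p dvd int g * int (idx t)"
    by (rule dvd_lincomb[of _ _ _ _ 1 "-1"]) simp
  then have "int p dvd int g \<or> int p dvd int (idx t)" by (rule p_dvd_prod)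
  then have "int p dvd int (idx t)" using user_not_dvd[OF assms(2)] by blast
  then have "idx t = 0" using p_not_dvd[of "int (idx t)"] assms(4) by (cases "idx t = 0") auto
  then show ?thesis using t by simp
qed

text \<open>Let \<open>b\<close> be the index offset of the two delays. If \<open>b\<close> were at
  most the least index of the class, \<open>b\<close> would be 0 and the delay unchanged. Otherwise
  all indices of the class are below \<open>b\<close>, which forces \<open>b = q - j\<close> with
  \<open>0 < j < p\<close>, and the hit conditions determine \<open>j\<close>.\<close>

lemma shiftedI:
  assumes g: "g \<in> {1..p - 1}" and d: "d < d'"
    and sub: "\<And>T. act g d T \<Longrightarrow> [idx (T - d) = \<nu>] (mod p) \<Longrightarrow> act g d' T"
  shows "\<exists>j. shifted g j d d'"
proof -
  define \<tau> where "\<tau> = d' - d"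
  define b where "b = off d d'"
  have b: "0 \<le> b" "b < int q" "int q dvd int p * b - int \<tau>"
    using off_range[of d d'] off_dvd[of d d'] d by (auto simp: b_def \<tau>_def of_nat_diff)
  have sub': "d' \<le> d + t \<and> int (idx (d + t - d')) = (if b \<le> int (idx t) then int (idx t) - b else int (idx t) - b + int q)
      \<and> hit g (d + t - d')" if t: "hit g t" "[idx t = \<nu>] (mod p)" for t
  proof -
    have "act g d (d + t)" using t by (simp add: act_def)
    then have "act g d' (d + t)" using sub t by simp
    then show ?thesis using idx_off[of d "d + t" d'] by (simp add: act_def b_def)
  qed
  \<comment> \<open>Comparison of the hit conditions of a kept slot under both delays; an index that
    wraps contributes \<open>q\<close>, which is 1 modulo \<open>p\<close>, hence
    \<open>b - 1\<close>.\<close>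
  have step: "int p dvd int \<tau> - int g * (if b \<le> int (idx t) then b else b - 1)"
    if t: "hit g t" "[idx t = \<nu>] (mod p)" for t
  proof -
    note s = sub'[OF t]
    have "int p dvd int (d + t - d') - int g * int (idx (d + t - d'))" using s unfolding hit_dvd by blast
    moreover have "int p dvd int t - int g * int (idx t)" using t by (simp add: hit_dvd)
    ultimately have 1: "int p dvd int (d + t - d') - int g * int (idx (d + t - d')) - (int t - int g * int (idx t))"
      by (rule dvd_diff)
    have 2: "int (d + t - d') = int t - int \<tau>" using s d by (simp add: \<tau>_def of_nat_diff)
    show ?thesis
    proof (cases "b \<le> int (idx t)")
      case True
      then have 3: "int (idx (d + t - d')) = int (idx t) - b" using s by simp
      show ?thesis
        using True by (intro dvd_lincomb[OF 1 1, of _ "-1" 0]) (simp add: 2 3 algebra_simps)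
    next
      case False
      then have 3: "int (idx (d + t - d')) = int (idx t) - b + int q" using s by simp
      show ?thesis
        using False by (intro dvd_lincomb[OF 1 p_dvd_q, of _ "-1" "- int g"]) (simp add: 2 3 algebra_simps)
    qed
  qed
  \<comment> \<open>This transmission is kept, so it does not precede the new start and the delay
    grows by less than \<open>q\<close>.\<close>
  obtain t0 where t0: "t0 < q" "hit g t0" "[idx t0 = \<nu>] (mod p)" by (rule ex_early_hit)
  have \<tau>: "0 < \<tau>" "\<tau> < q" using sub'[OF t0(2,3)] t0(1) d by (auto simp: \<tau>_def)
  have ex: "\<exists>t. hit g t \<and> idx t = n" if "n < q" for n using ex_hit[OF that] by metis
  have g0: "\<not> int p dvd int g" by (rule user_not_dvd[OF g])
  show ?thesis
  proof (cases "b \<le> int (\<nu> mod p)")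
    case True
    have bp: "b < int p" using True p_ge_3 by (simp add: order.strict_trans1 zmod_int)
    obtain t where t: "hit g t" "idx t = \<nu> mod p" using ex[of "\<nu> mod p"] q_gt_p p_ge_3
      by (meson less_trans mod_less_divisor less_le_trans zero_less_numeral)
    have "int p dvd int \<tau> - int g * b" using step[OF t(1)] t(2) True by (simp add: cong_def)
    moreover have "int p * b = int \<tau>"
    proof (rule dvd_small_eq[OF b(3)])
      have "int p * b \<le> int p * int p" using bp by (intro mult_left_mono) auto
      also have "\<dots> < int q" using q_gt by (metis of_nat_less_iff of_nat_mult)
      finally show "int p * b < int q" .
    qed (use b \<tau> in auto)
    ultimately have "int p dvd int g * b"
      by (metis dvd_triv_left dvd_diff_right_iff)
    then have "int p dvd b" using p_dvd_prod g0 by blast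
    then have "b = 0" using bp b(1) p_not_dvd[of b] by fastforce
    then show ?thesis using \<open>int p * b = int \<tau>\<close> \<tau> by simp
  next
    case False
    \<comment> \<open>An index of the class at or above \<open>b\<close> would make
      \<open>\<tau>\<close> congruent to both \<open>g * b\<close> and \<open>g * (b - 1)\<close>
      modulo \<open>p\<close>.\<close>
    have small: "int n < b" if n: "n < q" "[n = \<nu>] (mod p)" for n
    proof (rule ccontr)
      assume nb: "\<not> int n < b"
      obtain t where t: "hit g t" "idx t = n" using ex[OF n(1)] by blast
      obtain u where u: "hit g u" "idx u = \<nu> mod p" using ex[of "\<nu> mod p"] q_gt_p p_ge_3
        by (meson less_trans mod_less_divisor less_le_trans zero_less_numeral)
      have 1: "int p dvd int \<tau> - int g * b" using step[OF t(1)] t(2) n(2) nb by simp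
      have 2: "int p dvd int \<tau> - int g * (b - 1)" using step[OF u(1)] u(2) False by (simp add: cong_def)
      have "int p dvd int g" by (rule dvd_lincomb[OF 1 2, of _ "-1" 1]) (simp add: algebra_simps)
      then show False using g0 by simp
    qed
    define j where "j = nat (int q - b)"
    have j: "int j = int q - b" "1 \<le> j" using b by (auto simp: j_def)
    have jp: "j < p"
    proof -
      \<comment> \<open>The representative of the class among the last \<open>p\<close> indices. The
        summand \<open>k * p * p + p = q * p\<close> keeps the subtraction exact.\<close>
      define n where "n = q - p + (\<nu> + k * p * p + p - (q - p)) mod p"
      have "p \<le> q" using q_gt_p by simp
      have "k * p \<le> k * p * p" using p_ge_3 by simp
      then have le: "q - p \<le> \<nu> + k * p * p + p" using p_ge_3 unfolding q_eq by linarith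
      have "[n = q - p + (\<nu> + k * p * p + p - (q - p))] (mod p)" by (simp add: n_def cong_def mod_simps)
      also have "q - p + (\<nu> + k * p * p + p - (q - p)) = \<nu> + (k * p + 1) * p" using le by (simp add: algebra_simps)
      also have "[\<nu> + (k * p + 1) * p = \<nu>] (mod p)" unfolding cong_def by (rule mod_mult_self1)
      finally have n\<nu>: "[n = \<nu>] (mod p)" .
      have "(\<nu> + k * p * p + p - (q - p)) mod p < p" using p_ge_3 by simp
      then have nq: "n < q" unfolding n_def using \<open>p \<le> q\<close> by linarith
      have "int q - int p \<le> int n" using \<open>p \<le> q\<close> by (simp add: n_def of_nat_diff)
      also have "\<dots> < b" by (rule small[OF nq n\<nu>])
      finally show ?thesis using j by simp
    qed
    have "int q dvd (int q - int p * int j) - int \<tau>"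
      by (rule dvd_lincomb[OF b(3) dvd_refl, of _ 1 "1 - int p"]) (simp add: j algebra_simps)
    moreover have "int p * int j < int q"
    proof -
      have "p * j \<le> p * p" using jp by simp
      then have "p * j < q" using q_gt by linarith
      then show ?thesis by (metis of_nat_less_iff of_nat_mult)
    qed
    ultimately have tau: "int q - int p * int j = int \<tau>"
      using \<tau> j(2) p_ge_3 by (intro dvd_small_eq) auto
    obtain u where u: "hit g u" "idx u = \<nu> mod p" using ex[of "\<nu> mod p"] q_gt_p p_ge_3
      by (meson less_trans mod_less_divisor less_le_trans zero_less_numeral)
    have 2: "int p dvd int \<tau> - int g * (b - 1)" using step[OF u(1)] u(2) False by (simp add: cong_def)
    have 3: "int p dvd int p * int j" by simp
    have 4: "int p dvd int \<tau> - 1" by (rule dvd_lincomb[OF p_dvd_q 3, of _ 1 "-1"]) (simp add: tau[symmetric])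
    have 5: "int p dvd 1 - int g * (b - 1)" by (rule dvd_lincomb[OF 2 4, of _ 1 "-1"]) (simp add: algebra_simps)
    have "int p dvd int g * int j + 1"
      by (rule dvd_lincomb[OF 5 p_dvd_q, of _ 1 "int g"]) (simp add: j algebra_simps)
    moreover have "int d' + int p * int j = int d + int q" using tau d by (simp add: \<tau>_def of_nat_diff)
    then have "d' + p * j = d + q" by (metis of_nat_add of_nat_eq_iff of_nat_mult)
    ultimately have "shifted g j d d'"
      using d j(2) jp by (simp add: shifted_def)
    then show ?thesis by blast
  qed
qed

lemma off_eq_idx: "d \<le> d' \<Longrightarrow> off d d' = int (idx (d' - d))"
  using idx_dvd[of "d' - d"] idx_less[of "d' - d"] by (intro off_unique) (auto simp: of_nat_diff)

lemma shifted_idx: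
  assumes "shifted g j d d'" "d' \<le> T"
  shows "idx (T - d') = (if idx (T - d) + j < q then idx (T - d) + j else idx (T - d) + j - q)"
proof -
  have s: "d < d'" "1 \<le> j" "j < p" "int d' + int p * int j = int d + int q"
    using assms(1) by (auto simp: shifted_def) (metis of_nat_add of_nat_mult)
  have "off d d' = int q - int j"
  proof (rule off_unique)
    have "int p * (int q - int j) - (int d' - int d) = int q * (int p - 1)"
      using s(4) by (simp add: algebra_simps)
    then show "int q dvd int p * (int q - int j) - (int d' - int d)" by simp
  qed (use s q_gt_p in auto)
  then show ?thesis using idx_off[of d T d'] s assms(2) idx_less[of "T - d"] by (auto split: if_splits)
qed

text \<open>Without wrap-around the slot and \<open>g\<close> times the index both drop by 1 modulo
  \<open>p\<close>. With it the index also loses \<open>q\<close>, which is 1 modulo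
  \<open>p\<close>, and the two hit conditions differ by \<open>g\<close>, which \<open>p\<close>
  does not divide.\<close>

lemma shifted_act:
  assumes g: "g \<in> {1..p - 1}" and s: "shifted g j d d'" and T: "d' \<le> T"
  shows "idx (T - d) + j < q \<Longrightarrow> act g d T \<longleftrightarrow> act g d' T"
    and "q \<le> idx (T - d) + j \<Longrightarrow> act g d T \<Longrightarrow> \<not> act g d' T"
proof -
  let ?n = "idx (T - d)"
  have s': "d < d'" "int d' + int p * int j = int d + int q" "int p dvd int g * int j + 1"
    using s by (auto simp: shifted_def) (metis of_nat_add of_nat_mult)
  have "int p dvd (int g * int j + 1) + (int q - 1) - int p * int j"
    by (intro dvd_diff dvd_add s'(3) p_dvd_q) simp
  then have r: "int p dvd int (T - d) - int g * int ?n - (int (T - d') - int g * (int ?n + int j))"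
    by (rule back_subst) (use s'(1,2) T in \<open>simp add: algebra_simps of_nat_diff\<close>)
  have le: "d \<le> T" using s'(1) T by simp
  {
    assume "?n + j < q"
    then have "int (idx (T - d')) = int ?n + int j" using shifted_idx[OF s T] by simp
    then show "act g d T \<longleftrightarrow> act g d' T"
      unfolding act_def hit_dvd using r le T
      by (metis add_diff_cancel_left' diff_add_cancel dvd_add_left_iff dvd_diff_right_iff)
  next
    assume n: "q \<le> ?n + j" and a: "act g d T"
    show "\<not> act g d' T"
    proof
      assume a': "act g d' T"
      have i: "int (idx (T - d')) = int ?n + int j - int q" using shifted_idx[OF s T] n by (simp add: of_nat_diff)
      have 1: "int p dvd int (T - d) - int g * int ?n" using a unfolding act_def hit_dvd by blast
      have 2: "int p dvd int (T - d') - int g * int (idx (T - d'))" using a' unfolding act_def hit_dvd by blast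
      have "int p dvd (int (T - d) - int g * int ?n) - (int (T - d') - int g * int (idx (T - d')))"
        by (rule dvd_diff[OF 1 2])
      then have "int p dvd int g * int q"
        by (rule dvd_lincomb[OF r, of _ _ 1 "-1"]) (simp add: i algebra_simps)
      then have "int p dvd int g" by (rule dvd_lincomb[OF _ p_dvd_q, of _ _ 1 "- int g"]) (simp add: algebra_simps)
      then show False using user_not_dvd[OF g] by simp
    qed
  }
qed

text \<open>User \<open>h\<close> has delay \<open>c\<close> in one configuration and \<open>c'\<close> in the other. It accounts for a slot \<open>S\<close>
  that user \<open>g\<close> loses by starting later and for a slot \<open>R\<close> that \<open>g\<close> loses in a late frame.\<close>

lemma gain_residue:
  assumes gh: "g \<in> {1..p - 1}" "h \<in> {1..p - 1}" "g \<noteq> h"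
    and sg: "shifted g j d e" and first: "d \<le> c" "d \<le> c'"
    and sh: "shifted h i c c' \<or> shifted h i c' c"
    and S: "act g d S" "S < e" "act h c' S" "\<not> act h c S"
    and R: "act g d R" "q \<le> idx (R - d) + j" "c \<le> R" "act h c' R" "\<not> act h c R"
    and SR: "int p dvd int (idx (S - d)) - int (idx (R - d))"
    and T: "act g d T" "act h c' T" "T < e \<or> q \<le> idx (T - d) + j"
  shows "int p dvd int (idx (T - d)) - int (idx (S - d))"
proof -
  have sg': "d < e" "1 \<le> j" "j < p" "e + p * j = d + q" using sg by (auto simp: shifted_def)
  have pq: "2 * p + j < q"
  proof -
    have "3 * p \<le> p * p" using p_ge_3 by simp
    then show ?thesis using q_gt sg'(3) by linarith
  qed
  have early: "t < q" if "d + t < e" for t using that sg'(4) by linarith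
  have cS: "c' \<le> S" "d \<le> S" and cR: "c' \<le> R" "d \<le> R" using S R by (auto simp: act_def)
  \<comment> \<open>If \<open>h\<close> starts earlier in the second configuration, its wrap-around
    index \<open>b\<close> is so small that no relevant slot lies before it. If \<open>h\<close>
    starts later, the assumptions contradict each other.\<close>
  show ?thesis
  proof (cases "shifted h i c' c")
    case True
    then have i: "1 \<le> i" "i < p" by (auto simp: shifted_def)
    have late: "q \<le> idx (R - c') + i"
      using shifted_act(1)[OF gh(2) True R(3)] R(4,5) by (meson not_le)
    define b where "b = idx (c' - d)"
    have ob: "off d c' = int b" unfolding b_def by (rule off_eq_idx[OF first(2)])
    have ce: "c' - d < q" "c' - d + p * j < q" using cS(1) S(2) first(2) sg'(4) by linarith+
    \<comment> \<open>The index of \<open>R\<close> for \<open>h\<close> is one of the last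
      \<open>i\<close>. Without wrap-around it is \<open>b\<close> less than the index for
      \<open>g\<close>; with wrap-around \<open>c'\<close> would have one of the last indices for
      \<open>g\<close>, which \<open>late_idx\<close> rules out because
      \<open>c' \<le> S < e\<close>.\<close>
    have "b < i"
    proof (cases "b \<le> idx (R - d)")
      case True
      then show ?thesis using idx_off[OF cR(2,1)] late idx_less[of "R - d"] by (simp add: ob)
    next
      case False
      then have "q \<le> idx (c' - d) + (j - 1)" using R(2) sg'(2) by (simp add: b_def)
      then have "q \<le> c' - d + p * (j - 1)" using sg'(3) by (intro late_idx[OF ce(1)]) auto
      also have "\<dots> \<le> c' - d + p * j" by simp
      finally show ?thesis using ce(2) by simp
    qed
    then have cd: "c' - d = p * b" using early_idx[OF ce(1)] i by (simp add: b_def)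
    have side: "off d c' \<le> int (idx (T - d))" if T: "act g d T" "act h c' T" "T < e \<or> q \<le> idx (T - d) + j" for T
    proof (rule ccontr)
      assume "\<not> ?thesis"
      then have nb: "idx (T - d) < b" by (simp add: ob)
      then have "idx (T - d) < p" using \<open>b < i\<close> i(2) by simp
      moreover have "\<not> q \<le> idx (T - d) + j" using calculation pq by simp
      moreover have "hit g (T - d)" "d \<le> T" "c' \<le> T" using T(1,2) by (auto simp: act_def)
      moreover have "T - d < q" using T(3) calculation early[of "T - d"] by auto
      ultimately have "T - d = 0" using early_hit_multiple gh(1) by blast
      then have "p * b = 0" using cd first(2) \<open>c' \<le> T\<close> \<open>d \<le> T\<close> by simp
      then show False using nb p_ge_3 by simp
    qed
    show ?thesis
      by (rule hit_residue[OF gh T(1,2) S(1,3)]) (use side[OF T] side[OF S(1,3)] S(2) in simp)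
  next
    case False
    then have sh: "shifted h i c c'" using sh by simp
    then have i: "1 \<le> i" "i < p" "c < c'" by (auto simp: shifted_def)
    \<comment> \<open>A later start gains a slot only where the old index wraps, and there the new
      index is below \<open>i\<close>.\<close>
    have lost: "idx (U - c') < p" if "act h c' U" "\<not> act h c U" for U
    proof -
      have U: "c' \<le> U" using that(1) by (simp add: act_def)
      have "q \<le> idx (U - c) + i" using shifted_act(1)[OF gh(2) sh U] that by (meson not_le)
      then show ?thesis using shifted_idx[OF sh U] idx_less[of "U - c"] i(2) by simp
    qed
    have "S - c' < q" using early[of "S - d"] S(2) cS first(2) by simp
    then have "S - c' = 0"
      using S(3) lost[OF S(3,4)] gh(2) by (intro early_hit_multiple) (auto simp: act_def)
    then have S0: "S = c'" using cS by simp
    have ob: "off d c' = int (idx (S - d))" unfolding S0 by (rule off_eq_idx[OF first(2)])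
    have rp: "idx (R - c') < p" by (rule lost[OF R(4,5)])
    note e = idx_off[OF cR(2,1), unfolded ob]
    show ?thesis
    proof (cases "idx (S - d) \<le> idx (R - d)")
      case True
      then have e': "int (idx (R - c')) = int (idx (R - d)) - int (idx (S - d))" using e by simp
      then have "int p dvd int (idx (R - c'))" using SR by (simp add: dvd_diff_commute)
      then have "idx (R - c') = 0" using rp p_not_dvd[of "int (idx (R - c'))"] by (cases "idx (R - c') = 0") auto
      then have "idx (S - d) = idx (R - d)" using e' by simp
      then have "q \<le> (S - d) + p * j"
        using R(2) sg'(3) early[of "S - d"] S(2) cS by (intro late_idx) auto
      then show ?thesis using S(2) sg'(4) cS by linarith
    next
      case False
      then have "int (idx (R - c')) = int (idx (R - d)) - int (idx (S - d)) + int q" using e by simp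
      then have "idx (R - d) < idx (R - c')" using idx_less[of "S - d"] by linarith
      then show ?thesis using R(2) rp pq by linarith
    qed
  qed
qed

section \<open>Identification of active users and delays\<close>

lemma mult_residues_inj:
  assumes "\<not> int p dvd int j"
  shows "inj_on (\<lambda>y. y * j mod p) {..<p}"
proof (rule inj_onI)
  fix x y assume xy: "x \<in> {..<p}" "y \<in> {..<p}" "x * j mod p = y * j mod p"
  have "int (x * j) mod int p = int (y * j) mod int p" using xy(3) by (metis zmod_int)
  then have "int p dvd int (x * j) - int (y * j)" by (rule mod_eq_dvd_iff[THEN iffD1])
  then have "int p dvd (int x - int y) * int j" by (simp add: algebra_simps)
  then have "int p dvd int x - int y" using p_dvd_prod assms by blast
  then have "int x mod int p = int y mod int p" by (rule mod_eq_dvd_iff[THEN iffD2])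
  then show "x = y" using xy(1,2) by simp
qed

text \<open>Slots \<open>p * s - y\<close> with index \<open>y * k + s\<close> are used again. As
  \<open>g * j\<close> is -1, such a slot is a hit once its index is \<open>y * j\<close> modulo
  \<open>p\<close>, and \<open>s + j \<le> k\<close> puts it before \<open>e\<close>. Distinct
  \<open>y\<close> give distinct residues, so it suffices to count the admissible
  \<open>y\<close>.\<close>

lemma early_residues:
  assumes s: "shifted g j d e"
  shows "p - j \<le> card {idx (T - d) mod p | T. act g d T \<and> T < e}" (is "_ \<le> card ?E")
proof -
  have s': "d < e" "1 \<le> j" "j < p" "e + p * j = d + q" "int p dvd int g * int j + 1"
    using s by (auto simp: shifted_def)
  have jk: "j < k" using s'(3) p_le_k by simp
  have nj: "\<not> int p dvd int j" using s'(2,3) by (intro p_not_dvd) auto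
  define Y where "Y = {y. y < p \<and> (\<exists>s. 1 \<le> s \<and> s \<le> p \<and> s + j \<le> k \<and> int p dvd int s + int y * int (k - j))}"
  have "y * j mod p \<in> ?E" if "y \<in> Y" for y
  proof -
    from \<open>y \<in> Y\<close> obtain s where y: "y < p" and s: "1 \<le> s" "s \<le> p" "s + j \<le> k" "int p dvd int s + int y * int (k - j)"
      unfolding Y_def by blast
    define n where "n = y * k + s"
    define t where "t = p * s - y"
    have "p * 1 \<le> p * s" using s(1) by (intro mult_le_mono2)
    then have yt: "y \<le> p * s" using y by linarith
    have it: "int t = int p * int s - int y" using yt by (simp add: t_def of_nat_diff)
    have "p * (s + j) \<le> p * k" using s(3) by (intro mult_le_mono2)
    then have tj: "t + p * j < q" unfolding t_def q_eq by (simp add: algebra_simps)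
    have "n \<le> (p - 1) * k + p" unfolding n_def using y s(2) by (intro add_mono mult_le_mono1) auto
    also have "\<dots> < q" using p_le_k p_ge_3 by (cases p) (auto simp: q_eq algebra_simps)
    finally have n: "n < q" .
    have "int p * int n - int t = int q * int y" unfolding it by (simp add: n_def q_eq algebra_simps)
    then have i: "idx t = n" using n by (intro idx_unique) auto
    have ny: "int p dvd int n - int y * int j"
      using s(4) jk by (simp add: n_def of_nat_diff algebra_simps)
    have "int p dvd - int g * (int n - int y * int j) - int y * (int g * int j + 1)"
      by (rule dvd_lincomb[OF ny s'(5), of _ "- int g" "- int y"]) simp
    then have "int p dvd int t - int g * int n"
      by (rule dvd_lincomb[of _ _ "int p" _ 1 "int s"]) (simp_all add: it algebra_simps)
    then have "hit g t" by (simp add: hit_dvd i)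
    then have "act g d (d + t) \<and> d + t < e" using tj s'(4) by (simp add: act_def)
    moreover have "y * j mod p = idx (d + t - d) mod p"
    proof -
      have "int n mod int p = int (y * j) mod int p" using ny by (intro mod_eq_dvd_iff[THEN iffD2]) simp
      then have "n mod p = y * j mod p" by (metis of_nat_eq_iff zmod_int)
      then show ?thesis by (simp add: i)
    qed
    ultimately show ?thesis by blast
  qed
  then have sub: "(\<lambda>y. y * j mod p) ` Y \<subseteq> ?E" by blast
  have fin: "finite ?E" by (rule finite_subset[of _ "{..<p}"]) (use p_ge_3 in auto)
  have "card Y = card ((\<lambda>y. y * j mod p) ` Y)"
    by (rule card_image[symmetric], rule inj_on_subset[OF mult_residues_inj[OF nj]]) (auto simp: Y_def)
  also have "\<dots> \<le> card ?E" by (rule card_mono[OF fin sub])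
  finally have YE: "card Y \<le> card ?E" .
  have finY: "finite Y" by (rule finite_subset[of _ "{..<p}"]) (auto simp: Y_def)
  \<comment> \<open>If \<open>p\<close> divides \<open>k - j\<close>, then \<open>s = p\<close>
    serves every \<open>y\<close>; otherwise the values of \<open>s\<close> from 1 to
    \<open>p - j\<close> determine distinct \<open>y\<close>.\<close>
  have "p - j \<le> card Y"
  proof (cases "int p dvd int (k - j)")
    case True
    then have "p dvd k - j" by (simp only: int_dvd_int_iff)
    then have "p \<le> k - j" using jk by (simp add: dvd_imp_le)
    then have "{..<p} \<subseteq> Y" using True p_ge_3 by (auto simp: Y_def intro!: exI[of _ p])
    then show ?thesis using card_mono[OF finY, of "{..<p}"] by simp
  next
    case False
    then have "coprime (int (k - j)) (int p)"
      using prime_imp_coprime[OF prime_int_p] coprime_commute by blast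
    then obtain x where x: "[int (k - j) * x = 1] (mod int p)" using cong_solve_coprime_int by blast
    then have x': "int p dvd int (k - j) * x - 1" by (simp add: cong_iff_dvd_diff)
    define f where "f s = nat ((- int s * x) mod int p)" for s :: nat
    have f: "f s < p" "int p dvd int s + int (f s) * int (k - j)" for s
    proof -
      have e: "int (f s) = (- int s * x) mod int p" using p_ge_3 by (simp add: f_def)
      show "f s < p" using p_ge_3 by (simp add: f_def nat_less_iff)
      have 1: "int p dvd int (f s) - (- int s * x)"
        using e mod_eq_dvd_iff[of "int (f s)" "int p" "- int s * x"] by simp
      show "int p dvd int s + int (f s) * int (k - j)"
        by (rule dvd_lincomb[OF 1 x', of _ "int (k - j)" "- int s"]) (simp add: algebra_simps)
    qed
    have "inj_on f {1..p - j}"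
    proof (rule inj_onI)
      fix a b assume ab: "a \<in> {1..p - j}" "b \<in> {1..p - j}" "f a = f b"
      have "int p dvd int a - int b"
        by (rule dvd_lincomb[OF f(2)[of a] f(2)[of b], of _ 1 "-1"]) (simp add: ab(3))
      then have "int a mod int p = int b mod int p" by (rule mod_eq_dvd_iff[THEN iffD2])
      moreover have "a < p" "b < p" using ab(1,2) s'(2) p_ge_3 by auto
      ultimately show "a = b" by simp
    qed
    then have "p - j = card (f ` {1..p - j})" by (simp add: card_image)
    also have "\<dots> \<le> card Y"
    proof (rule card_mono[OF finY])
      show "f ` {1..p - j} \<subseteq> Y"
      proof
        fix y assume "y \<in> f ` {1..p - j}"
        then obtain s where s: "s \<in> {1..p - j}" "y = f s" by blast
        have "1 \<le> s" "s \<le> p" "s + j \<le> k" using s(1) p_le_k s'(3) by auto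
        then show "y \<in> Y" using f[of s] s(2) unfolding Y_def by blast
      qed
    qed
    finally show ?thesis .
  qed
  then show ?thesis using YE by simp
qed

text \<open>The indices from \<open>q - j\<close> to \<open>q - 1\<close> are incongruent modulo
  \<open>p\<close> and recur in every frame. Frame number \<open>z\<close> is late enough, as it
  begins no earlier than slot \<open>z\<close>.\<close>

lemma late_residues:
  assumes j: "j < p"
  shows "j \<le> card {idx (T - d) mod p | T. act g d T \<and> z \<le> T \<and> q \<le> idx (T - d) + j}" (is "_ \<le> card ?E")
proof -
  have "(q - a) mod p \<in> ?E" if a: "a \<in> {1..j}" for a
  proof -
    have "q - a < q" using a q_pos by simp
    then obtain T where T: "T \<in> frame d z" "act g d T" "idx (T - d) = q - a" using ex_frame by metis
    have "1 * z \<le> p * q * z" using p_ge_3 q_pos by (intro mult_le_mono1) (simp add: Suc_le_eq)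
    moreover have "d + p * q * z \<le> T" using T(1) by (simp add: frame_def)
    ultimately have "z \<le> T" by linarith
    moreover have "q \<le> idx (T - d) + j"
    proof -
      have "a \<le> j" using a by simp
      then show ?thesis unfolding T(3) using j q_gt_p by linarith
    qed
    ultimately show ?thesis using T(2,3) by (metis (mono_tags, lifting) mem_Collect_eq)
  qed
  then have sub: "(\<lambda>a. (q - a) mod p) ` {1..j} \<subseteq> ?E" by blast
  have fin: "finite ?E" by (rule finite_subset[of _ "{..<p}"]) (use p_ge_3 in auto)
  have "inj_on (\<lambda>a. (q - a) mod p) {1..j}"
  proof (rule inj_onI)
    fix a b assume ab: "a \<in> {1..j}" "b \<in> {1..j}" "(q - a) mod p = (q - b) mod p"
    then have le: "a < p" "b < p" "a \<le> q" "b \<le> q" using j q_gt_p by auto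
    have "int (q - a) mod int p = int (q - b) mod int p" using ab(3) by (metis zmod_int)
    then have "int p dvd int (q - a) - int (q - b)" by (rule mod_eq_dvd_iff[THEN iffD1])
    then have "int p dvd int b - int a" using le by (simp add: of_nat_diff)
    then have "int b mod int p = int a mod int p" by (rule mod_eq_dvd_iff[THEN iffD2])
    then show "a = b" using le by simp
  qed
  then have "j = card ((\<lambda>a. (q - a) mod p) ` {1..j})" by (simp add: card_image)
  also have "\<dots> \<le> card ?E" by (rule card_mono[OF fin sub])
  finally show ?thesis .
qed

section \<open>Comparison of two configurations with the same slot pattern\<close>

definition actives :: "nat set \<Rightarrow> (nat \<Rightarrow> nat) \<Rightarrow> nat \<Rightarrow> nat set" where
  "actives A d T = {g \<in> A. act g (d g) T}"

text \<open>All that the channel shows apart from packet contents: idle, reception or collision, but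
  neither the number nor the identity of colliding users.\<close>

definition same_activity :: "nat set \<Rightarrow> (nat \<Rightarrow> nat) \<Rightarrow> nat set \<Rightarrow> (nat \<Rightarrow> nat) \<Rightarrow> bool" where
  "same_activity A d A' d' \<longleftrightarrow> (\<forall>T. (actives A d T = {} \<longleftrightarrow> actives A' d' T = {}) \<and>
     (is_singleton (actives A d T) \<longleftrightarrow> is_singleton (actives A' d' T)))"

lemma same_activity_sym: "same_activity A d A' d' \<Longrightarrow> same_activity A' d' A d"
  by (simp add: same_activity_def)

text \<open>A user outside \<open>A'\<close> would need all \<open>q\<close> packets of a frame
  covered by users of \<open>A'\<close>, each covering at most \<open>k + 1\<close> of them.\<close>

lemma active_users_subset:
  assumes same: "same_activity A d A' d'"
    and A: "A \<subseteq> {1..p - 1}" and A': "A' \<subseteq> {1..p - 1}" "card A' = (p + 1) div 2"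
  shows "A \<subseteq> A'"
proof
  fix g assume g: "g \<in> A"
  show "g \<in> A'"
  proof (rule ccontr)
    assume g': "g \<notin> A'"
    have fin: "finite A'" using A'(1) finite_subset by blast
    let ?X = "{T \<in> frame (d g) 0. act g (d g) T}"
    have "?X \<subseteq> (\<Union>h\<in>A'. {T \<in> frame (d g) 0. act g (d g) T \<and> act h (d' h) T})"
    proof
      fix T assume T: "T \<in> ?X"
      then have "actives A d T \<noteq> {}" using g by (auto simp: actives_def)
      then have "actives A' d' T \<noteq> {}" using same by (simp add: same_activity_def)
      then show "T \<in> (\<Union>h\<in>A'. {T \<in> frame (d g) 0. act g (d g) T \<and> act h (d' h) T})"
        using T by (auto simp: actives_def)
    qed
    moreover have "finite (\<Union>h\<in>A'. {T \<in> frame (d g) 0. act g (d g) T \<and> act h (d' h) T})"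
      using fin by (simp add: frame_def)
    ultimately have "card ?X \<le> card (\<Union>h\<in>A'. {T \<in> frame (d g) 0. act g (d g) T \<and> act h (d' h) T})"
      by (rule card_mono[rotated])
    then have "q \<le> card (\<Union>h\<in>A'. {T \<in> frame (d g) 0. act g (d g) T \<and> act h (d' h) T})"
      by (simp only: card_frame)
    also have "\<dots> \<le> (\<Sum>h\<in>A'. card {T \<in> frame (d g) 0. act g (d g) T \<and> act h (d' h) T})"
      by (rule card_UN_le[OF fin])
    also have "\<dots> \<le> (\<Sum>h\<in>A'. k + 1)"
      using g g' A A'(1) by (intro sum_mono cross_correlation) auto
    also have "\<dots> = (p + 1) div 2 * (k + 1)" using A'(2) by simp
    finally have "2 * q \<le> 2 * ((p + 1) div 2) * (k + 1)" by simp
    also have "2 * ((p + 1) div 2) = p + 1" using odd_p by simp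
    \<comment> \<open>This amounts to \<open>k * p + 1 \<le> p + k\<close>, whereas
      \<open>k * p\<close> is at least \<open>3 * k\<close>.\<close>
    finally have "2 * k * p + 2 \<le> (p + 1) * (k + 1)" by (simp add: q_eq)
    moreover have "3 * k \<le> k * p" using p_ge_3 by simp
    ultimately show False using p_le_k p_ge_3 by (simp add: algebra_simps)
  qed
qed

context
  fixes A :: "nat set"
  assumes A: "A \<subseteq> {1..p - 1}" "card A = (p + 1) div 2"
begin

lemma finite_A: "finite A"
  using A(1) finite_subset by blast

lemma card_interferers: "g \<in> A \<Longrightarrow> 2 * card (A - {g}) = p - 1"
  using A(2) odd_p by (simp add: finite_A)

text \<open>The interferers meet \<open>g\<close> in at most \<open>p - 1\<close> residues, so some
  class \<open>\<nu>\<close> is free of them. Its slots are busy in the second configuration too,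
  which only \<open>g\<close> under its new delay can explain, and \<open>shiftedI\<close>
  applies.\<close>

lemma changed_imp_shifted:
  assumes same: "same_activity A d A d'" and g: "g \<in> A" "d g < d' g"
  shows "\<exists>j. shifted g j (d g) (d' g)"
proof -
  let ?R = "\<lambda>h. {idx (T - d g) mod p | T. act g (d g) T \<and> act h (d' h) T}"
  have "card (\<Union>h\<in>A - {g}. ?R h) \<le> (\<Sum>h\<in>A - {g}. card (?R h))"
    by (rule card_UN_le) (simp add: finite_A)
  also have "\<dots> \<le> (\<Sum>h\<in>A - {g}. 2)"
    using A(1) g(1) by (intro sum_mono card_residues_le_2) auto
  also have "\<dots> < p" using card_interferers[OF g(1)] p_ge_3 by simp
  finally have less: "card (\<Union>h\<in>A - {g}. ?R h) < p" .
  have "finite (\<Union>h\<in>A - {g}. ?R h)"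
    by (rule finite_subset[of _ "{..<p}"]) (use p_ge_3 in auto)
  then have "\<not> {..<p} \<subseteq> (\<Union>h\<in>A - {g}. ?R h)"
    using card_mono[of "\<Union>h\<in>A - {g}. ?R h" "{..<p}"] less by auto
  then obtain \<nu> where "\<nu> \<in> {..<p}" and \<nu>': "\<nu> \<notin> (\<Union>h\<in>A - {g}. ?R h)" unfolding subset_eq by blast
  then have \<nu>: "\<nu> < p" by simp
  show ?thesis
  proof (rule shiftedI[OF _ g(2)])
    show "g \<in> {1..p - 1}" using A(1) g(1) by blast
    fix T assume T: "act g (d g) T" "[idx (T - d g) = \<nu>] (mod p)"
    then have "actives A d T \<noteq> {}" using g(1) by (auto simp: actives_def)
    then have "actives A d' T \<noteq> {}" using same by (simp add: same_activity_def)
    then obtain h where h: "h \<in> A" "act h (d' h) T" by (auto simp: actives_def)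
    have "h = g"
    proof (rule ccontr)
      assume "h \<noteq> g"
      moreover have "\<nu> = idx (T - d g) mod p" using T(2) \<nu> by (simp add: cong_def)
      ultimately show False using \<nu>' h T(1) by blast
    qed
    then show "act g (d' g) T" using h by simp
  qed
qed

text \<open>A slot lost by user \<open>g\<close> is used in the second configuration by two users, or by one that is silent
  there in the first, since the channel distinguishes collisions from receptions. By \<open>gain_residue\<close> a
  single user making up for both an early and a late loss in the same residue meets no other residue,
  so it can be given weight two.\<close>

lemma earliest_start_unchanged:
  assumes same: "same_activity A d A d'" and g: "g \<in> A" "d g < d' g"
    and first: "\<And>h. h \<in> A \<Longrightarrow> d h \<noteq> d' h \<Longrightarrow> d g \<le> d h \<and> d g \<le> d' h"
  shows False
proof -
  obtain j where sg: "shifted g j (d g) (d' g)" using changed_imp_shifted[OF same g] by blast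
  have j: "1 \<le> j" "j < p" using sg by (auto simp: shifted_def)
  have users: "h \<in> {1..p - 1}" if "h \<in> A" for h using A(1) that by blast
  \<comment> \<open>From slot \<open>z\<close> on every user of \<open>A\<close> has started in both
    configurations.\<close>
  define z where "z = (\<Sum>h\<in>A. d h + d' h)"
  have z: "d h \<le> z" "d' h \<le> z" if "h \<in> A" for h
    using member_le_sum[of h A "\<lambda>h. d h + d' h"] that finite_A by (auto simp: z_def)
  define early where "early T \<longleftrightarrow> act g (d g) T \<and> T < d' g" for T
  define late where "late T \<longleftrightarrow> act g (d g) T \<and> z \<le> T \<and> q \<le> idx (T - d g) + j" for T
  define \<rho> where "\<rho> T = idx (T - d g) mod p" for T
  define Res1 where "Res1 = {\<rho> T | T. early T}"
  define Res2 where "Res2 = {\<rho> T | T. late T}"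
  define E where "E \<nu> = {h \<in> A - {g}. \<exists>T. (early T \<or> late T) \<and> act h (d' h) T \<and> \<rho> T = \<nu>}" for \<nu>
  define H where "H h = {\<nu> \<in> {..<p}. h \<in> E \<nu>}" for h
  \<comment> \<open>As \<open>card (H h)\<close> will be at most 2, this choice keeps the product
    \<open>w h * card (H h)\<close> at most 2.\<close>
  define w :: "nat \<Rightarrow> nat" where "w h = (if card (H h) \<le> 1 then 2 else 1)" for h
  have finE: "finite (E \<nu>)" for \<nu> using finite_A by (simp add: E_def)
  have Res1: "Res1 = {idx (T - d g) mod p | T. act g (d g) T \<and> T < d' g}"
    unfolding Res1_def early_def \<rho>_def ..
  have Res2: "Res2 = {idx (T - d g) mod p | T. act g (d g) T \<and> z \<le> T \<and> q \<le> idx (T - d g) + j}"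
    unfolding Res2_def late_def \<rho>_def ..
  \<comment> \<open>At least \<open>p - j\<close> early and at least \<open>j\<close> late residues;
    a residue of both kinds counts twice.\<close>
  have cardM: "p \<le> card Res1 + card Res2"
    using early_residues[OF sg, folded Res1] late_residues[OF j(2), of "d g" g z, folded Res2] j(2) by simp
  have lost: "\<not> act g (d' g) T" if "early T \<or> late T" for T
    using that shifted_act(2)[OF users[OF g(1)] sg] z(2)[OF g(1)]
    by (auto simp: early_def late_def act_def[of g "d' g"])
  have cover: "\<exists>h\<in>A - {g}. act h (d' h) T \<and>
      ((\<exists>h'\<in>A - {g}. h' \<noteq> h \<and> act h' (d' h') T) \<or> \<not> act h (d h) T)" if T: "early T \<or> late T" for T
  proof -
    have gT: "g \<in> actives A d T" using T g(1) by (auto simp: actives_def early_def late_def)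
    then have "actives A d' T \<noteq> {}" using same unfolding same_activity_def by blast
    then obtain h where h: "h \<in> A" "act h (d' h) T" by (auto simp: actives_def)
    have hg: "h \<noteq> g" using h(2) lost[OF T] by blast
    show ?thesis
    proof (cases "\<exists>h'\<in>A - {g}. h' \<noteq> h \<and> act h' (d' h') T")
      case True
      then show ?thesis using h hg by blast
    next
      case False
      then have "actives A d' T = {h}" using h lost[OF T] by (auto simp: actives_def)
      then have "is_singleton (actives A d T)" using same unfolding same_activity_def by simp
      then have "h \<notin> actives A d T" using gT hg by (auto simp: is_singleton_def)
      then show ?thesis using h hg by (auto simp: actives_def)
    qed
  qed
  have w1: "1 \<le> w h" for h by (simp add: w_def)
  have single: "1 \<le> (\<Sum>h\<in>E \<nu>. w h)" if "\<nu> \<in> Res1 \<union> Res2" for \<nu>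
  proof -
    obtain T where T: "early T \<or> late T" "\<rho> T = \<nu>" using \<open>\<nu> \<in> Res1 \<union> Res2\<close> by (auto simp: Res1_def Res2_def)
    obtain h where "h \<in> A - {g}" "act h (d' h) T" using cover[OF T(1)] by blast
    then have "h \<in> E \<nu>" using T by (auto simp: E_def)
    then have "w h \<le> (\<Sum>h\<in>E \<nu>. w h)" using finE by (intro member_le_sum) auto
    then show ?thesis using w1[of h] by simp
  qed
  have double: "2 \<le> (\<Sum>h\<in>E \<nu>. w h)" if \<nu>: "\<nu> \<in> Res1" "\<nu> \<in> Res2" for \<nu>
  proof -
    obtain S where S: "early S" "\<rho> S = \<nu>" using \<nu>(1) by (auto simp: Res1_def)
    obtain R where R: "late R" "\<rho> R = \<nu>" using \<nu>(2) by (auto simp: Res2_def)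
    show ?thesis
    proof (cases "\<exists>x\<in>E \<nu>. \<exists>y\<in>E \<nu>. x \<noteq> y")
      case True
      then obtain x y where xy: "x \<in> E \<nu>" "y \<in> E \<nu>" "x \<noteq> y" by blast
      have "w x + w y = (\<Sum>h\<in>{x, y}. w h)" using xy(3) by simp
      also have "\<dots> \<le> (\<Sum>h\<in>E \<nu>. w h)" using xy finE by (intro sum_mono2) auto
      finally show ?thesis using w1[of x] w1[of y] by simp
    next
      case False
      have inE: "h \<in> E \<nu>" if "h \<in> A - {g}" "act h (d' h) T" "early T \<or> late T" "\<rho> T = \<nu>" for h T
        using that by (auto simp: E_def)
      obtain h where h: "h \<in> A - {g}" "act h (d' h) S" "\<not> act h (d h) S"
        using cover[of S] S False inE by metis
      obtain h' where h': "h' \<in> A - {g}" "act h' (d' h') R" "\<not> act h' (d h') R"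
        using cover[of R] R False inE by metis
      have hh: "h' = h" using False inE h(1,2) h'(1,2) S R by metis
      have hA: "h \<in> A" "h \<noteq> g" using h(1) by auto
      have ne: "d h \<noteq> d' h" using h(2,3) by metis
      have "(\<exists>i. shifted h i (d h) (d' h)) \<or> (\<exists>i. shifted h i (d' h) (d h))"
        using ne changed_imp_shifted[OF same hA(1)] changed_imp_shifted[OF same_activity_sym[OF same] hA(1)]
        by (meson linorder_neqE_nat)
      then obtain i where i: "shifted h i (d h) (d' h) \<or> shifted h i (d' h) (d h)" by blast
      have cong: "int p dvd int (idx (S - d g)) - int (idx (R - d g))"
      proof -
        have "int (idx (S - d g)) mod int p = int (idx (R - d g)) mod int p"
          using S(2) R(2) unfolding \<rho>_def by (metis zmod_int)
        then show ?thesis by (rule mod_eq_dvd_iff[THEN iffD1])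
      qed
      have only: "\<rho> T = \<nu>" if T: "early T \<or> late T" "act h (d' h) T" for T
      proof -
        have "int p dvd int (idx (T - d g)) - int (idx (S - d g))"
        proof (rule gain_residue[OF users[OF g(1)] users[OF hA(1)] _ sg _ _ i])
          show "g \<noteq> h" using hA(2) by simp
          show "d g \<le> d h" "d g \<le> d' h" using first[OF hA(1) ne] by auto
          show "act g (d g) S" "S < d' g" using S(1) by (auto simp: early_def)
          show "act h (d' h) S" "\<not> act h (d h) S" by (rule h)+
          show "act g (d g) R" "q \<le> idx (R - d g) + j" "d h \<le> R"
            using R(1) z(1)[OF hA(1)] by (auto simp: late_def)
          show "act h (d' h) R" "\<not> act h (d h) R" using h'(2,3) hh by auto
          show "int p dvd int (idx (S - d g)) - int (idx (R - d g))" by (rule cong)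
          show "act g (d g) T" using T(1) by (auto simp: early_def late_def)
          show "act h (d' h) T" by (rule T(2))
          show "T < d' g \<or> q \<le> idx (T - d g) + j" using T(1) by (auto simp: early_def late_def)
        qed
        then have "int (idx (T - d g)) mod int p = int (idx (S - d g)) mod int p"
          by (rule mod_eq_dvd_iff[THEN iffD2])
        then show ?thesis using S(2) unfolding \<rho>_def by (metis of_nat_eq_iff zmod_int)
      qed
      have "H h \<subseteq> {\<nu>}" unfolding H_def E_def using only by blast
      then have "card (H h) \<le> 1" using card_mono[of "{\<nu>}" "H h"] by simp
      then have w2: "w h = 2" by (simp add: w_def)
      have "h \<in> E \<nu>" using inE[OF h(1,2)] S by blast
      then have "w h \<le> (\<Sum>h\<in>E \<nu>. w h)" using finE by (intro member_le_sum) auto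
      then show ?thesis using w2 by simp
    qed
  qed
  have "card Res1 = (\<Sum>\<nu><p. if \<nu> \<in> Res1 then 1 else 0)" "card Res2 = (\<Sum>\<nu><p. if \<nu> \<in> Res2 then 1 else 0)"
  proof -
    have "Res1 \<subseteq> {..<p}" "Res2 \<subseteq> {..<p}" using p_ge_3 by (auto simp: Res1_def Res2_def \<rho>_def)
    then have "{..<p} \<inter> Res1 = Res1" "{..<p} \<inter> Res2 = Res2" by blast+
    then show "card Res1 = (\<Sum>\<nu><p. if \<nu> \<in> Res1 then 1 else 0)" "card Res2 = (\<Sum>\<nu><p. if \<nu> \<in> Res2 then 1 else 0)"
      by (simp_all flip: sum.inter_restrict)
  qed
  then have "card Res1 + card Res2 = (\<Sum>\<nu><p. (if \<nu> \<in> Res1 then 1 else 0) + (if \<nu> \<in> Res2 then 1 else 0))"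
    by (simp add: sum.distrib)
  also have "\<dots> \<le> (\<Sum>\<nu><p. \<Sum>h\<in>E \<nu>. w h)"
  proof (rule sum_mono)
    fix \<nu>
    show "(if \<nu> \<in> Res1 then 1 else 0) + (if \<nu> \<in> Res2 then 1 else 0) \<le> (\<Sum>h\<in>E \<nu>. w h)"
      using single[of \<nu>] double[of \<nu>]
      by (cases "\<nu> \<in> Res1"; cases "\<nu> \<in> Res2") (simp_all add: numeral_2_eq_2)
  qed
  also have "\<dots> = (\<Sum>\<nu><p. \<Sum>h\<in>A - {g}. if h \<in> E \<nu> then w h else 0)"
  proof (rule sum.cong[OF refl])
    fix \<nu>
    have "E \<nu> = {h \<in> A - {g}. h \<in> E \<nu>}" by (auto simp: E_def)
    then show "(\<Sum>h\<in>E \<nu>. w h) = (\<Sum>h\<in>A - {g}. if h \<in> E \<nu> then w h else 0)"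
      using sum.inter_filter[of "A - {g}" w "\<lambda>h. h \<in> E \<nu>"] finite_A by simp
  qed
  also have "\<dots> = (\<Sum>h\<in>A - {g}. \<Sum>\<nu><p. if h \<in> E \<nu> then w h else 0)" by (rule sum.swap)
  also have "\<dots> = (\<Sum>h\<in>A - {g}. w h * card (H h))"
  proof (rule sum.cong[OF refl])
    fix h
    have "(\<Sum>\<nu><p. if h \<in> E \<nu> then w h else 0) = (\<Sum>\<nu>\<in>H h. w h)"
      unfolding H_def by (rule sum.inter_filter[symmetric]) simp
    then show "(\<Sum>\<nu><p. if h \<in> E \<nu> then w h else 0) = w h * card (H h)" by simp
  qed
  also have "\<dots> \<le> (\<Sum>h\<in>A - {g}. 2)"
  proof (rule sum_mono)
    fix h assume h: "h \<in> A - {g}"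
    let ?X = "{idx (T - d g) mod p | T. act g (d g) T \<and> act h (d' h) T}"
    have "H h \<subseteq> ?X" by (auto simp: H_def E_def \<rho>_def early_def late_def)
    moreover have "finite ?X" "card ?X \<le> 2"
      using card_residues_le_2[OF users[OF g(1)] users[of h]] h by auto
    ultimately have "card (H h) \<le> 2" using card_mono le_trans by blast
    then show "w h * card (H h) \<le> 2" by (auto simp: w_def)
  qed
  also have "\<dots> < p" using card_interferers[OF g(1)] p_ge_3 by simp
  finally show False using cardM by simp
qed

text \<open>Among the users with changed delay, the one with the least start in either configuration
  contradicts \<open>earliest_start_unchanged\<close>, if necessary with the configurations
  exchanged.\<close>

lemma delays_determined:
  assumes same: "same_activity A d A d'" and g: "g \<in> A"
  shows "d g = d' g"
proof (rule ccontr)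
  assume "d g \<noteq> d' g"
  then obtain f where f: "f \<in> A \<and> d f \<noteq> d' f"
    and min: "\<And>h. h \<in> A \<and> d h \<noteq> d' h \<Longrightarrow> min (d f) (d' f) \<le> min (d h) (d' h)"
    using ex_has_least_nat[of "\<lambda>g. g \<in> A \<and> d g \<noteq> d' g" g "\<lambda>h. min (d h) (d' h)"] g by blast
  have least: "min (d f) (d' f) \<le> d h" "min (d f) (d' f) \<le> d' h" if "h \<in> A" "d h \<noteq> d' h" for h
    using min[of h] that by simp_all
  show False
  proof (cases "d f < d' f")
    case True
    then have "min (d f) (d' f) = d f" by simp
    then show False
      using f True least by (intro earliest_start_unchanged[OF same, of f]) auto
  next
    case False
    then have "d' f < d f" "min (d f) (d' f) = d' f" using f by auto
    then show False
      using f least by (intro earliest_start_unchanged[OF same_activity_sym[OF same], of f]) auto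
  qed
qed

end

section \<open>Recovery of the information words\<close>

lemma info_packets_eq:
  assumes "2 * n = p - 1"
  shows "info_packets p k + n * (k + 1) = q"
proof -
  obtain m where p: "p = 2 * m + 1" using odd_p by (elim oddE)
  have n: "n = m" using assms p by simp
  have "k * p + k - p + 3 = 2 * (k * m + k - m + 1)"
    using p_le_k by (simp add: p algebra_simps)
  then have "info_packets p k = k * m + k - m + 1" by (simp add: info_packets_def)
  moreover have "m \<le> k" using p_le_k p by simp
  ultimately show ?thesis by (simp add: q_eq p n algebra_simps)
qed

text \<open>Each of the \<open>(p - 1) / 2\<close> interferers spoils at most \<open>k + 1\<close>
  of the \<open>q\<close> packets of a frame; \<open>info_packets_eq\<close> identifies what is
  left.\<close>

lemma clean_slots:
  assumes A: "A \<subseteq> {1..p - 1}" "card A = (p + 1) div 2" and g: "g \<in> A"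
  shows "info_packets p k \<le> card {T \<in> frame (d g) m. actives A d T = {g}}" (is "_ \<le> card ?C")
proof -
  have fin: "finite A" using A(1) finite_subset by blast
  let ?X = "{T \<in> frame (d g) m. act g (d g) T}"
  let ?Y = "\<lambda>h. {T \<in> frame (d g) m. act g (d g) T \<and> act h (d h) T}"
  have finF: "finite (frame (d g) m)" by (simp add: frame_def)
  have "?X \<subseteq> ?C \<union> (\<Union>h\<in>A - {g}. ?Y h)" using g by (auto simp: actives_def)
  then have "card ?X \<le> card (?C \<union> (\<Union>h\<in>A - {g}. ?Y h))"
    using fin finF by (intro card_mono) auto
  also have "\<dots> \<le> card ?C + card (\<Union>h\<in>A - {g}. ?Y h)" by (rule card_Un_le)
  also have "card (\<Union>h\<in>A - {g}. ?Y h) \<le> (\<Sum>h\<in>A - {g}. card (?Y h))"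
    using fin by (intro card_UN_le) auto
  also have "\<dots> \<le> (\<Sum>h\<in>A - {g}. k + 1)"
    using g A(1) by (intro sum_mono cross_correlation) auto
  also have "\<dots> = card (A - {g}) * (k + 1)" by simp
  finally have "q \<le> card ?C + card (A - {g}) * (k + 1)" by (simp only: card_frame add_le_cancel_left)
  then show ?thesis using info_packets_eq[OF card_interferers[OF A g]] by linarith
qed

section \<open>The channel output and its decoding\<close>

context
  fixes c :: "'a list \<Rightarrow> nat \<Rightarrow> 'a"
begin

text \<open>The packet in slot \<open>n\<close> of a frame carries the code symbol at position
  \<open>idx n\<close>, so each of the \<open>q\<close> positions is sent exactly once per
  frame.\<close>

definition chan_output :: "nat set \<Rightarrow> (nat \<Rightarrow> nat) \<Rightarrow> (nat \<Rightarrow> nat \<Rightarrow> 'a list) \<Rightarrow> nat \<Rightarrow> 'a channel_symbol" where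
  "chan_output A d u = collision_channel A
     (\<lambda>g. user_signal (mcrt_seq p q \<gamma> g) (p * q) (\<lambda>w n. c w (idx n)) (d g) (u g))"

lemma chan_output_eq:
  "chan_output A d u T = (if actives A d T = {} then Idle
     else if is_singleton (actives A d T)
       then let g = the_elem (actives A d T) in Received (c (u g ((T - d g) div (p * q))) (idx (T - d g)))
     else Collision)"
proof -
  have idx_mod: "idx (t mod (p * q)) = idx t" for t
    using idx_period[of "t mod (p * q)" "t div (p * q)"] by (simp add: mult.commute)
  have sig: "user_signal (mcrt_seq p q \<gamma> g) (p * q) (\<lambda>w n. c w (idx n)) (d g) (u g) T =
      (if act g (d g) T then Some (c (u g ((T - d g) div (p * q))) (idx (T - d g))) else None)" for g
    by (simp add: user_signal_def act_def mcrt_seq_eq_1 idx_mod del: One_nat_def)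
  have set: "{g \<in> A. user_signal (mcrt_seq p q \<gamma> g) (p * q) (\<lambda>w n. c w (idx n)) (d g) (u g) T \<noteq> None} = actives A d T"
    by (auto simp: sig actives_def)
  show ?thesis
  proof (cases "is_singleton (actives A d T)")
    case True
    then obtain h where h: "actives A d T = {h}" by (auto simp: is_singleton_def)
    then have "act h (d h) T" by (auto simp: actives_def)
    then show ?thesis unfolding chan_output_def collision_channel_def set by (simp add: h sig Let_def)
  next
    case False
    then show ?thesis unfolding chan_output_def collision_channel_def set by (simp add: Let_def)
  qed
qed

lemma same_output_imp_same_activity:
  assumes "chan_output A d u = chan_output A' d' u'"
  shows "same_activity A d A' d'"
  unfolding same_activity_def
proof
  fix T
  have "chan_output A d u T = chan_output A' d' u' T" using assms by simp
  then show "(actives A d T = {} \<longleftrightarrow> actives A' d' T = {}) \<and>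
     (is_singleton (actives A d T) \<longleftrightarrow> is_singleton (actives A' d' T))"
    unfolding chan_output_eq by (auto simp: Let_def is_singleton_def split: if_splits)
qed

text \<open>Once users and delays agree, the clean slots of a frame are receptions from the same
  user at the same code positions on both sides, and there are enough of them for the code to
  determine the word.\<close>

lemma chan_output_determines:
  assumes mds: "\<And>w w' I. w \<in> info_words Q (info_packets p k) \<Longrightarrow> w' \<in> info_words Q (info_packets p k) \<Longrightarrow>
       I \<subseteq> {..<q} \<Longrightarrow> info_packets p k \<le> card I \<Longrightarrow> (\<And>i. i \<in> I \<Longrightarrow> c w i = c w' i) \<Longrightarrow> w = w'"
    and A: "A \<subseteq> {1..p - 1}" "card A = (p + 1) div 2"
    and A': "A' \<subseteq> {1..p - 1}" "card A' = (p + 1) div 2"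
    and u: "\<And>g j. g \<in> A \<Longrightarrow> u g j \<in> info_words Q (info_packets p k)"
    and u': "\<And>g j. g \<in> A' \<Longrightarrow> u' g j \<in> info_words Q (info_packets p k)"
    and eq: "chan_output A d u = chan_output A' d' u'"
  shows "A = A' \<and> (\<forall>g\<in>A. u g = u' g)"
proof -
  note same = same_output_imp_same_activity[OF eq]
  have AA': "A = A'"
    using active_users_subset[OF same A(1) A'] active_users_subset[OF same_activity_sym[OF same] A'(1) A]
    by blast
  have dd': "d h = d' h" if "h \<in> A" for h
    using delays_determined[OF A same[folded AA'] that] .
  then have act_eq: "actives A' d' T = actives A d T" for T
    unfolding AA'[symmetric] by (auto simp: actives_def)
  have "u g m = u' g m" if g: "g \<in> A" for g m
  proof -
    let ?C = "{T \<in> frame (d g) m. actives A d T = {g}}"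
    let ?I = "(\<lambda>T. idx (T - d g)) ` ?C"
    show "u g m = u' g m"
    proof (rule mds[OF u[OF g] u'])
      show "g \<in> A'" using g AA' by simp
      show "?I \<subseteq> {..<q}" using idx_less by blast
      have "?C \<subseteq> {T \<in> frame (d g) m. act g (d g) T}" by (auto simp: actives_def)
      then have "card ?I = card ?C" by (intro card_image inj_on_subset[OF inj_on_frame[of "d g" m g]])
      then show "info_packets p k \<le> card ?I" using clean_slots[OF A g, of d m] by simp
      fix i assume "i \<in> ?I"
      then obtain T where T: "T \<in> frame (d g) m" "actives A d T = {g}" "i = idx (T - d g)" by blast
      have "p * q > 0" using p_ge_3 q_pos by simp
      have "T - d g = p * q * m + (T - (d g + p * q * m))" "T - (d g + p * q * m) < p * q"
        using T(1) by (auto simp: frame_def)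
      then have m: "(T - d g) div (p * q) = m"
        using \<open>p * q > 0\<close> by (metis add.right_neutral div_less div_mult_self4 less_numeral_extra(3))
      have "chan_output A d u T = chan_output A' d' u' T" using eq by simp
      then show "c (u g m) i = c (u' g m) i"
        unfolding chan_output_eq act_eq T(2) using dd'[OF g] by (simp add: T(3) m[unfolded dd'[OF g]] Let_def)
    qed
  qed
  then show ?thesis using AA' by blast
qed

end

lemma each_active_user_can_send_mcrt:
  fixes Q :: "'a set"
  assumes Q: "primepow (card Q)" "q \<le> card Q"
  shows "each_active_user_can_send (mcrt_seq p q \<gamma>) (p * q) {1..p - 1} ((p + 1) div 2) Q (info_packets p k)"
proof -
  obtain c :: "'a list \<Rightarrow> nat \<Rightarrow> 'a" where
    c: "\<And>w i. w \<in> info_words Q (info_packets p k) \<Longrightarrow> i < q \<Longrightarrow> c w i \<in> Q" and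
    mds: "\<And>w w' I. w \<in> info_words Q (info_packets p k) \<Longrightarrow> w' \<in> info_words Q (info_packets p k) \<Longrightarrow>
       I \<subseteq> {..<q} \<Longrightarrow> info_packets p k \<le> card I \<Longrightarrow> (\<And>i. i \<in> I \<Longrightarrow> c w i = c w' i) \<Longrightarrow> w = w'"
    using ex_mds_code[OF Q, of "info_packets p k"] by metis
  define valid where "valid A u \<longleftrightarrow> A \<subseteq> {1..p - 1} \<and> card A = (p + 1) div 2 \<and>
    (\<forall>g\<in>A. \<forall>j. u g j \<in> info_words Q (info_packets p k))" for A and u :: "nat \<Rightarrow> nat \<Rightarrow> 'a list"
  \<comment> \<open>The decoder chooses any result consistent with the output;
    \<open>chan_output_determines\<close> makes it unique.\<close>
  define dec where "dec y = (SOME v. \<exists>A d u. valid A u \<and> y = chan_output c A d u \<and>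
    v = (\<lambda>g. if g \<in> A then Some (u g) else None))" for y
  have dec: "dec (chan_output c A d u) = (\<lambda>g. if g \<in> A then Some (u g) else None)" if "valid A u" for A d u
    unfolding dec_def
  proof (rule some_equality)
    show "\<exists>A' d' u'. valid A' u' \<and> chan_output c A d u = chan_output c A' d' u' \<and>
      (\<lambda>g. if g \<in> A then Some (u g) else None) = (\<lambda>g. if g \<in> A' then Some (u' g) else None)"
      using \<open>valid A u\<close> by blast
    fix v assume "\<exists>A' d' u'. valid A' u' \<and> chan_output c A d u = chan_output c A' d' u' \<and>
      v = (\<lambda>g. if g \<in> A' then Some (u' g) else None)"
    then obtain A' d' u' where v: "valid A' u'" "chan_output c A d u = chan_output c A' d' u'"
      "v = (\<lambda>g. if g \<in> A' then Some (u' g) else None)" by blast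
    have "A = A' \<and> (\<forall>g\<in>A. u g = u' g)"
    proof (rule chan_output_determines)
      show "A \<subseteq> {1..p - 1}" "card A = (p + 1) div 2" "A' \<subseteq> {1..p - 1}" "card A' = (p + 1) div 2"
        using \<open>valid A u\<close> v(1) by (simp_all add: valid_def)
      show "u g j \<in> info_words Q (info_packets p k)" if "g \<in> A" for g j
        using \<open>valid A u\<close> that by (simp add: valid_def)
      show "u' g j \<in> info_words Q (info_packets p k)" if "g \<in> A'" for g j
        using v(1) that by (simp add: valid_def)
    qed (fact mds v(2))+
    then show "v = (\<lambda>g. if g \<in> A then Some (u g) else None)" using v(3) by auto
  qed
  show ?thesis
    unfolding each_active_user_can_send_def
  proof (intro exI[of _ "\<lambda>g w n. c w (idx n)"] exI[of _ dec] conjI allI ballI impI)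
    fix w n assume "w \<in> info_words Q (info_packets p k)"
    then show "c w (idx n) \<in> Q" using c idx_less by blast
  next
    fix A d and u :: "nat \<Rightarrow> nat \<Rightarrow> 'a list"
    assume "A \<subseteq> {1..p - 1}" "card A = (p + 1) div 2" "\<forall>g\<in>A. \<forall>j. u g j \<in> info_words Q (info_packets p k)"
    then have "valid A u" by (simp add: valid_def)
    from dec[OF this, of d]
    show "dec (collision_channel A (\<lambda>g. user_signal (mcrt_seq p q \<gamma> g) (p * q) (\<lambda>w n. c w (idx n)) (d g) (u g)))
        = (\<lambda>g. if g \<in> A then Some (u g) else None)"
      by (simp add: chan_output_def)
  qed
qed

lemma has_period_mcrt_seq: "has_period (mcrt_seq p q \<gamma> g) (p * q)"
proof -
  have "mcrt_seq p q \<gamma> g (t + p * q) = mcrt_seq p q \<gamma> g t" for t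
    using mcrt_seq_eq_1[of g "t + p * q"] mcrt_seq_eq_1[of g t] hit_period[of g t 1]
    by (auto simp: mcrt_seq_def split: if_splits)
  then show ?thesis using p_ge_3 q_pos by (simp add: has_period_def)
qed

end

theorem theorem10:
  fixes p k \<gamma> :: nat and Q :: "'a set"
  assumes "prime p" and "odd p" and "p \<le> k"
    and "[\<gamma> * p = 1] (mod (k * p + 1))"
    and "primepow (card Q)" and "k * p + 1 \<le> card Q"
  shows "each_active_user_can_send (mcrt_seq p (k * p + 1) \<gamma>) (p * (k * p + 1))
           {1..p - 1} ((p + 1) div 2) Q (info_packets p k)
       \<and> (\<forall>g\<in>{1..p - 1}. has_period (mcrt_seq p (k * p + 1) \<gamma> g) (p * (k * p + 1)))
       \<and> (k = p \<longrightarrow>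
            (\<forall>g\<in>{1..p - 1}. has_period (mcrt_seq p (p * p + 1) \<gamma> g) (p ^ 3 + p))
          \<and> (\<exists>R. achieves_throughput (mcrt_seq p (p * p + 1) \<gamma>) (p ^ 3 + p)
                   {1..p - 1} ((p + 1) div 2) Q R
               \<and> R \<ge> (real p + 1) / 2 * (0.5 * ((real p)\<^sup>2 + 3) / (real p ^ 3 + real p)))
          \<and> (real p + 1) / 2 * (0.5 * ((real p)\<^sup>2 + 3) / (real p ^ 3 + real p)) \<ge> 0.25)"
proof -
  interpret mcrt p k "k * p + 1" \<gamma>
    by unfold_locales (use assms in auto)
  note send = each_active_user_can_send_mcrt[OF assms(5,6)]
  show ?thesis
  proof (intro conjI impI ballI)
    assume kp: "k = p"
    have L: "p * (k * p + 1) = p ^ 3 + p" by (simp add: kp power3_eq_cube algebra_simps)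
    show "has_period (mcrt_seq p (p * p + 1) \<gamma> g) (p ^ 3 + p)" for g
      using has_period_mcrt_seq[of g, unfolded L] by (simp only: kp)
    have p0: "real p > 0" using p_ge_3 by simp
    obtain m where "p = 2 * m + 1" using odd_p by (elim oddE)
    then have half: "real ((p + 1) div 2) = (real p + 1) / 2" by simp
    have packets: "real (info_packets p p) = 0.5 * ((real p)\<^sup>2 + 3)"
      using info_packets_real[OF odd_p, of p] p_ge_3 by (simp add: power2_eq_square)
    \<comment> \<open>The throughput equals the stated bound, so the bound itself serves as
      \<open>R\<close>.\<close>
    have "system_throughput ((p + 1) div 2) (info_packets p p) (p ^ 3 + p)
        = (real p + 1) / 2 * (0.5 * ((real p)\<^sup>2 + 3) / (real p ^ 3 + real p))"
      by (simp only: system_throughput_def of_nat_mult of_nat_add of_nat_power half packets times_divide_eq_right)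
    moreover have "achieves_throughput (mcrt_seq p (p * p + 1) \<gamma>) (p ^ 3 + p) {1..p - 1} ((p + 1) div 2) Q
        (system_throughput ((p + 1) div 2) (info_packets p p) (p ^ 3 + p))"
      unfolding achieves_throughput_def using send[unfolded L] kp by auto
    ultimately show "\<exists>R. achieves_throughput (mcrt_seq p (p * p + 1) \<gamma>) (p ^ 3 + p)
                   {1..p - 1} ((p + 1) div 2) Q R
               \<and> R \<ge> (real p + 1) / 2 * (0.5 * ((real p)\<^sup>2 + 3) / (real p ^ 3 + real p))"
      by (metis order_refl)
    \<comment> \<open>The claim about 0.25 with its denominators cleared.\<close>
    have "real p ^ 3 + real p \<le> (real p + 1) * ((real p)\<^sup>2 + 3)"
      using p0 by (simp add: power3_eq_cube power2_eq_square algebra_simps)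
    moreover have "real p ^ 3 + real p > 0" using p0 by (simp add: add_pos_pos)
    ultimately show "(real p + 1) / 2 * (0.5 * ((real p)\<^sup>2 + 3) / (real p ^ 3 + real p)) \<ge> 0.25"
      by (simp add: field_simps)
  qed (use send has_period_mcrt_seq in auto)
qed

end
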